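(* Let $n\ge 1$, let $S$ be a finite set, and let $j\colon \mathcal A\to\mathcal B$ be an inclusion of full subcategories $\mathcal A\subseteq\mathcal B$ of the partially ordered set $\mathcal K_n^e(S)$. If $\mathcal A$ contains $\mathcal M_n^{\downarrow}(S)$, then $j$ is homotopy initial. If $\mathcal A$ contains $\mathcal M_n^{\uparrow}(S)$, then $j$ is homotopy final.
   Context: Partially ordered sets are regarded as categories with a (unique) morphism $\mu\to\nu$ exactly when $\mu\le\nu$; full subcategories are then subsets with the induced order. $|\mathcal A|$ denotes the geometric realization of the nerve of a small category $\mathcal A$. Homotopy initial/final: a functor $j\colon\mathcal A\to\mathcal B$ of small categories is homotopy final if for every object $b$ of $\mathcal B$ the geometric realization of the undercategory $(b\downarrow j)$ (objects: pairs $(a, b\to j(a))$) is contractible, and homotopy initial if for every $b$ the geometric realization of the overcategory $(j\downarrow b)$ (objects: pairs $(a, j(a)\to b)$) is contractible. The poset $\mathcal G_n(S)$: for a finite set $S$ and $n\ge1$, an object $\mu$ is a choice, for each pair $\{x,y\}$ of distinct elements of $S$ (edge of the complete graph on $S$), of a label $\mu\{x,y\}\in\{1,\dots,n\}$ and an orientation $\vec\mu\{x,y\}\in\{(x,y),(y,x)\}$. There is a morphism $\mu\to\nu$ iff for each $\{x,y\}$ either $\vec\mu\{x,y\}=\vec\nu\{x,y\}$ and $\mu\{x,y\}\le\nu\{x,y\}$, or $\vec\mu\{x,y\}\ne\vec\nu\{x,y\}$ and $\mu\{x,y\}<\nu\{x,y\}$. If $S$ is empty or a singleton, $\mathcal G_n(S)$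 has a single object. An oriented cycle in $\mu$ is a sequence $x_1,\dots,x_k$ ($k>1$) of distinct elements of $S$ with $\vec\mu\{x_i,x_{i+1}\}=(x_i,x_{i+1})$ for $1\le i<k$ and $\vec\mu\{x_k,x_1\}=(x_k,x_1)$. $\mathcal K_n^e(S)$ is the full subcategory of $\mathcal G_n(S)$ of objects with no oriented cycle all of whose edges $\{x_i,x_{i+1}\}$, $\{x_k,x_1\}$ have the same label. For an ordered partition $(S_1,S_2)$ of $S$ into two non-empty disjoint subsets with union $S$, and objects $\mu_1$ of $\mathcal G_n(S_1)$, $\mu_2$ of $\mathcal G_n(S_2)$, let $\mu_1\Box_i\mu_2$ ($1\le i\le n$) be the object of $\mathcal G_n(S)$ that restricts to $\mu_1$ on $S_1$ and to $\mu_2$ on $S_2$, and that assigns to each $\{x,y\}$ with $x\in S_1$, $y\in S_2$ the label $i$ and orientation $(x,y)$. $\mathcal M_n^{\uparrow}(S)$ and $\mathcal M_n^{\downarrow}(S)$ are the full subcategories of $\mathcal K_n^e(S)$ defined recursively on the cardinality of $S$: if $S$ has at most one element, each consists of the unique object. If $S$ has more than one element, $\mathcal M_n^{\uparrow}(S)$ consists of all objects $\mu_1\Box_i\mu_2$ for some ordered partition $(S_1,S_2)$, some $1\le i\le n$, and some $\mu_a\in\mathcal M_i^{\uparrow}(S_a)$ ($a=1,2$; labels in $\{1,\dots,i\}\subseteq\{1,\dots,n\}$); and $\mathcal M_n^{\downarrow}(S)$ consists of all objects $\mu_1\Box_i\mu_2$ for some ordered partition $(S_1,S_2)$, some $1\le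 i\le n$, and some $\mu_a\in\mathcal M_n^{\downarrow}(S_a)$ all of whose labels lie in $\{i,\dots,n\}$ ($a=1,2$). *)

theory Defs
  imports "HOL-Analysis.Analysis" "HOL-Homology.Simplices"
begin

section \<open>Small categories, functors, comma categories\<close>

record ('o, 'm) category =
  objs :: "'o set"
  arrs :: "'m set"
  src :: "'m \<Rightarrow> 'o"
  tgt :: "'m \<Rightarrow> 'o"
  idn :: "'o \<Rightarrow> 'm"
  cmp :: "'m \<Rightarrow> 'm \<Rightarrow> 'm"  \<comment> \<open>\<open>cmp C g f\<close> is \<open>f\<close> followed by \<open>g\<close>\<close>

definition is_category :: "('o, 'm) category \<Rightarrow> bool" where
  "is_category C \<longleftrightarrow>
     src C ` arrs C \<subseteq> objs C \<and> tgt C ` arrs C \<subseteq> objs C \<and>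
     (\<forall>a\<in>objs C. idn C a \<in> arrs C \<and> src C (idn C a) = a \<and> tgt C (idn C a) = a) \<and>
     (\<forall>f\<in>arrs C. \<forall>g\<in>arrs C. tgt C f = src C g \<longrightarrow>
        cmp C g f \<in> arrs C \<and> src C (cmp C g f) = src C f \<and> tgt C (cmp C g f) = tgt C g) \<and>
     (\<forall>f\<in>arrs C. cmp C f (idn C (src C f)) = f \<and> cmp C (idn C (tgt C f)) f = f) \<and>
     (\<forall>f\<in>arrs C. \<forall>g\<in>arrs C. \<forall>h\<in>arrs C. tgt C f = src C g \<and> tgt C g = src C h \<longrightarrow>
        cmp C h (cmp C g f) = cmp C (cmp C h g) f)"

text \<open>A functor is given by its action on objects and its action on arrows.\<close>

definition is_functor ::
    "('o, 'm) category \<Rightarrow> ('p, 'k) category \<Rightarrow> ('o \<Rightarrow> 'p) \<times> ('m \<Rightarrow> 'k) \<Rightarrow> bool" where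
  "is_functor C D F \<longleftrightarrow>
     fst F ` objs C \<subseteq> objs D \<and> snd F ` arrs C \<subseteq> arrs D \<and>
     (\<forall>f\<in>arrs C. src D (snd F f) = fst F (src C f) \<and> tgt D (snd F f) = fst F (tgt C f)) \<and>
     (\<forall>a\<in>objs C. snd F (idn C a) = idn D (fst F a)) \<and>
     (\<forall>f\<in>arrs C. \<forall>g\<in>arrs C. tgt C f = src C g \<longrightarrow>
        snd F (cmp C g f) = cmp D (snd F g) (snd F f))"

text \<open>An arrow of a comma category is stored as a triple (source object, underlying arrow of
  the domain category, target object), so that it determines its source and target.\<close>

definition overcategory ::
    "('o, 'm) category \<Rightarrow> ('p, 'k) category \<Rightarrow> ('o \<Rightarrow> 'p) \<times> ('m \<Rightarrow> 'k) \<Rightarrow> 'p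
      \<Rightarrow> ('o \<times> 'k, ('o \<times> 'k) \<times> 'm \<times> ('o \<times> 'k)) category" where
  "overcategory C D F b =
     (let Obs = {(a, f). a \<in> objs C \<and> f \<in> arrs D \<and> src D f = fst F a \<and> tgt D f = b} in
      \<lparr>objs = Obs,
       arrs = {((a, f), h, (a', f')). (a, f) \<in> Obs \<and> (a', f') \<in> Obs \<and>
                 h \<in> arrs C \<and> src C h = a \<and> tgt C h = a' \<and> cmp D f' (snd F h) = f},
       src = (\<lambda>(p, h, q). p),
       tgt = (\<lambda>(p, h, q). q),
       idn = (\<lambda>p. (p, idn C (fst p), p)),
       cmp = (\<lambda>(q', k, r) (p, h, q). (p, cmp C k h, r))\<rparr>)"

definition undercategory ::
    "('o, 'm) category \<Rightarrow> ('p, 'k) category \<Rightarrow> ('o \<Rightarrow> 'p) \<times> ('m \<Rightarrow> 'k) \<Rightarrow> 'p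
      \<Rightarrow> ('o \<times> 'k, ('o \<times> 'k) \<times> 'm \<times> ('o \<times> 'k)) category" where
  "undercategory C D F b =
     (let Obs = {(a, f). a \<in> objs C \<and> f \<in> arrs D \<and> src D f = b \<and> tgt D f = fst F a} in
      \<lparr>objs = Obs,
       arrs = {((a, f), h, (a', f')). (a, f) \<in> Obs \<and> (a', f') \<in> Obs \<and>
                 h \<in> arrs C \<and> src C h = a \<and> tgt C h = a' \<and> cmp D (snd F h) f = f'},
       src = (\<lambda>(p, h, q). p),
       tgt = (\<lambda>(p, h, q). q),
       idn = (\<lambda>p. (p, idn C (fst p), p)),
       cmp = (\<lambda>(q', k, r) (p, h, q). (p, cmp C k h, r))\<rparr>)"

text \<open>A set with a relation \<open>R\<close> (meant to be a partial order on it) as a category; the unique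
  arrow \<open>x \<rightarrow> y\<close> is the pair \<open>(x, y)\<close>. Full subcategories are obtained by shrinking \<open>P\<close>.\<close>

definition poset_cat :: "'a set \<Rightarrow> ('a \<Rightarrow> 'a \<Rightarrow> bool) \<Rightarrow> ('a, 'a \<times> 'a) category" where
  "poset_cat P R =
     \<lparr>objs = P,
      arrs = {(x, y). x \<in> P \<and> y \<in> P \<and> R x y},
      src = fst, tgt = snd,
      idn = (\<lambda>x. (x, x)),
      cmp = (\<lambda>g f. (fst f, snd g))\<rparr>"

definition inclusion_functor :: "('a \<Rightarrow> 'a) \<times> ('a \<times> 'a \<Rightarrow> 'a \<times> 'a)" where
  "inclusion_functor = (id, id)"

lemma is_category_poset_cat:
  assumes "\<And>x. x \<in> P \<Longrightarrow> R x x"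
    and "\<And>x y z. x \<in> P \<Longrightarrow> y \<in> P \<Longrightarrow> z \<in> P \<Longrightarrow> R x y \<Longrightarrow> R y z \<Longrightarrow> R x z"
  shows "is_category (poset_cat P R)"
  unfolding is_category_def poset_cat_def
  by (auto simp: image_subset_iff assms(1) intro: assms(2))

lemma is_functor_inclusion:
  assumes "A \<subseteq> B"
  shows "is_functor (poset_cat A R) (poset_cat B R) inclusion_functor"
  using assms unfolding is_functor_def poset_cat_def inclusion_functor_def by auto

section \<open>Nerve and geometric realization\<close>

text \<open>For a monotone \<open>\<theta>: [m] \<rightarrow> [k]\<close>, \<open>sop X m k \<theta>\<close> is the induced operator from
  \<open>k\<close>-simplices to \<open>m\<close>-simplices.\<close>

record 'x simplicial_set =
  simps :: "nat \<Rightarrow> 'x set"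
  sop :: "nat \<Rightarrow> nat \<Rightarrow> (nat \<Rightarrow> nat) \<Rightarrow> 'x \<Rightarrow> 'x"

definition ord_map :: "nat \<Rightarrow> nat \<Rightarrow> (nat \<Rightarrow> nat) \<Rightarrow> bool" where
  "ord_map m k \<theta> \<longleftrightarrow> mono_on {..m} \<theta> \<and> \<theta> ` {..m} \<subseteq> {..k}"

text \<open>The ordinal \<open>[k] = {0 < 1 < \<dots> < k}\<close> as a category.\<close>

definition ord_cat :: "nat \<Rightarrow> (nat, nat \<times> nat) category" where
  "ord_cat k = poset_cat {..k} (\<le>)"

text \<open>The \<open>k\<close>-simplices of the nerve are the functors \<open>[k] \<rightarrow> C\<close>; both components are made
  extensional so that distinct HOL pairs are distinct functors.\<close>

definition nerve ::
    "('o, 'm) category \<Rightarrow> ((nat \<Rightarrow> 'o) \<times> (nat \<times> nat \<Rightarrow> 'm)) simplicial_set" where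
  "nerve C =
     \<lparr>simps = (\<lambda>k. {F. is_functor (ord_cat k) C F \<and>
                     fst F \<in> extensional {..k} \<and> snd F \<in> extensional (arrs (ord_cat k))}),
      sop = (\<lambda>m k \<theta> F. (restrict (fst F \<circ> \<theta>) {..m},
                        restrict (\<lambda>(i, j). snd F (\<theta> i, \<theta> j)) (arrs (ord_cat m))))\<rparr>"

definition simplex_push :: "nat \<Rightarrow> (nat \<Rightarrow> nat) \<Rightarrow> (nat \<Rightarrow> real) \<Rightarrow> (nat \<Rightarrow> real)" where
  "simplex_push m \<theta> t = (\<lambda>j. \<Sum>i | i \<le> m \<and> \<theta> i = j. t i)"

text \<open>\<open>\<Coprod>\<^sub>k X\<^sub>k \<times> \<Delta>\<^sup>k\<close>, each \<open>X\<^sub>k\<close> being discrete.\<close>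

definition realization_sum ::
    "'x simplicial_set \<Rightarrow> ((nat \<times> 'x) \<times> (nat \<Rightarrow> real)) topology" where
  "realization_sum X =
     sum_topology (\<lambda>(k, x). subtopology (powertop_real UNIV) (standard_simplex k))
       (SIGMA k:UNIV. simps X k)"

definition realization_glue ::
    "'x simplicial_set \<Rightarrow> (((nat \<times> 'x) \<times> (nat \<Rightarrow> real)) \<times> ((nat \<times> 'x) \<times> (nat \<Rightarrow> real))) set" where
  "realization_glue X =
     {(((m, sop X m k \<theta> x), t), ((k, x), simplex_push m \<theta> t)) | m k \<theta> x t.
        ord_map m k \<theta> \<and> x \<in> simps X k \<and> t \<in> standard_simplex m}"

text \<open>Restricted to the space glued, this is the equivalence relation generated by the gluing.\<close>

definition realization_equiv ::
    "'x simplicial_set \<Rightarrow> (((nat \<times> 'x) \<times> (nat \<Rightarrow> real)) \<times> ((nat \<times> 'x) \<times> (nat \<Rightarrow> real))) set" where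
  "realization_equiv X = (realization_glue X \<union> (realization_glue X)\<inverse>)\<^sup>*"

definition quotient_topology :: "'p topology \<Rightarrow> ('p \<times> 'p) set \<Rightarrow> 'p set topology" where
  "quotient_topology T E =
     topology (\<lambda>U. U \<subseteq> topspace T // E \<and> openin T {p \<in> topspace T. E `` {p} \<in> U})"

lemma openin_quotient_topology:
  "openin (quotient_topology T E) U \<longleftrightarrow>
     U \<subseteq> topspace T // E \<and> openin T {p \<in> topspace T. E `` {p} \<in> U}"
proof -
  have 1: "{p \<in> topspace T. E `` {p} \<in> V \<inter> W} =
      {p \<in> topspace T. E `` {p} \<in> V} \<inter> {p \<in> topspace T. E `` {p} \<in> W}" for V W
    by auto
  have 2: "{p \<in> topspace T. E `` {p} \<in> \<Union>\<K>} = (\<Union>K\<in>\<K>. {p \<in> topspace T. E `` {p} \<in> K})" for \<K>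
    by auto
  have "istopology (\<lambda>U. U \<subseteq> topspace T // E \<and> openin T {p \<in> topspace T. E `` {p} \<in> U})"
    unfolding istopology_def 1 2 by blast
  then show ?thesis
    by (simp add: quotient_topology_def)
qed

lemma quotient_map_quotient_topology:
  "quotient_map T (quotient_topology T E) (\<lambda>p. E `` {p})"
proof -
  have "openin (quotient_topology T E) (topspace T // E)"
  proof -
    have "{p \<in> topspace T. E `` {p} \<in> topspace T // E} = topspace T"
      by (auto intro: quotientI)
    then show ?thesis
      by (simp add: openin_quotient_topology)
  qed
  then have top: "topspace (quotient_topology T E) = topspace T // E"
    by (meson openin_quotient_topology openin_subset openin_topspace subset_antisym)
  have "(\<lambda>p. E `` {p}) ` topspace T = topspace T // E"
    by (auto simp: quotient_def)
  then show ?thesis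
    by (simp add: quotient_map_def top openin_quotient_topology)
qed

definition geometric_realization ::
    "'x simplicial_set \<Rightarrow> ((nat \<times> 'x) \<times> (nat \<Rightarrow> real)) set topology" where
  "geometric_realization X = quotient_topology (realization_sum X) (realization_equiv X)"

text \<open>The library's \<^const>\<open>contractible_space\<close> holds for the empty space, which is not
  contractible in the sense needed for homotopy initial and final functors.\<close>

definition has_contractible_realization :: "('o, 'm) category \<Rightarrow> bool" where
  "has_contractible_realization C \<longleftrightarrow>
     topspace (geometric_realization (nerve C)) \<noteq> {} \<and>
     contractible_space (geometric_realization (nerve C))"

definition homotopy_final ::
    "('o, 'm) category \<Rightarrow> ('p, 'k) category \<Rightarrow> ('o \<Rightarrow> 'p) \<times> ('m \<Rightarrow> 'k) \<Rightarrow> bool" where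
  "homotopy_final C D F \<longleftrightarrow> is_category C \<and> is_category D \<and> is_functor C D F \<and>
     (\<forall>b\<in>objs D. has_contractible_realization (undercategory C D F b))"

definition homotopy_initial ::
    "('o, 'm) category \<Rightarrow> ('p, 'k) category \<Rightarrow> ('o \<Rightarrow> 'p) \<times> ('m \<Rightarrow> 'k) \<Rightarrow> bool" where
  "homotopy_initial C D F \<longleftrightarrow> is_category C \<and> is_category D \<and> is_functor C D F \<and>
     (\<forall>b\<in>objs D. has_contractible_realization (overcategory C D F b))"

section \<open>Labelled oriented complete graphs\<close>

definition edges :: "'a set \<Rightarrow> 'a set set" where
  "edges S = {{x, y} | x y. x \<in> S \<and> y \<in> S \<and> x \<noteq> y}"

text \<open>An object sends each edge to its label and its orientation.\<close>

type_synonym 'a graph_obj = "'a set \<Rightarrow> nat \<times> 'a \<times> 'a"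

definition lab :: "'a graph_obj \<Rightarrow> 'a set \<Rightarrow> nat" where
  "lab \<mu> e = fst (\<mu> e)"

definition ori :: "'a graph_obj \<Rightarrow> 'a set \<Rightarrow> 'a \<times> 'a" where
  "ori \<mu> e = snd (\<mu> e)"

definition G_objs :: "nat \<Rightarrow> 'a set \<Rightarrow> 'a graph_obj set" where
  "G_objs n S = {\<mu> \<in> extensional (edges S).
     \<forall>x\<in>S. \<forall>y\<in>S. x \<noteq> y \<longrightarrow> lab \<mu> {x, y} \<in> {1..n} \<and> ori \<mu> {x, y} \<in> {(x, y), (y, x)}}"

definition G_le :: "'a set \<Rightarrow> 'a graph_obj \<Rightarrow> 'a graph_obj \<Rightarrow> bool" where
  "G_le S \<mu> \<nu> \<longleftrightarrow> (\<forall>e\<in>edges S.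
     (ori \<mu> e = ori \<nu> e \<and> lab \<mu> e \<le> lab \<nu> e) \<or> (ori \<mu> e \<noteq> ori \<nu> e \<and> lab \<mu> e < lab \<nu> e))"

text \<open>\<open>x\<^sub>1, \<dots>, x\<^sub>k\<close> is the list \<open>xs\<close>; indices are shifted by one and taken modulo \<open>k\<close>, so that the
  closing edge \<open>{x\<^sub>k, x\<^sub>1}\<close> is the case \<open>i = k - 1\<close>.\<close>

definition oriented_cycle :: "'a set \<Rightarrow> 'a graph_obj \<Rightarrow> 'a list \<Rightarrow> bool" where
  "oriented_cycle S \<mu> xs \<longleftrightarrow> length xs > 1 \<and> distinct xs \<and> set xs \<subseteq> S \<and>
     (\<forall>i<length xs. ori \<mu> {xs ! i, xs ! (Suc i mod length xs)}
                       = (xs ! i, xs ! (Suc i mod length xs)))"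

definition monochromatic :: "'a graph_obj \<Rightarrow> 'a list \<Rightarrow> bool" where
  "monochromatic \<mu> xs \<longleftrightarrow>
     (\<exists>l. \<forall>i<length xs. lab \<mu> {xs ! i, xs ! (Suc i mod length xs)} = l)"

definition Ke_objs :: "nat \<Rightarrow> 'a set \<Rightarrow> 'a graph_obj set" where
  "Ke_objs n S = {\<mu> \<in> G_objs n S. \<not> (\<exists>xs. oriented_cycle S \<mu> xs \<and> monochromatic \<mu> xs)}"

definition graph_box ::
    "'a set \<Rightarrow> 'a set \<Rightarrow> nat \<Rightarrow> 'a graph_obj \<Rightarrow> 'a graph_obj \<Rightarrow> 'a graph_obj" where
  "graph_box S1 S2 i \<mu>1 \<mu>2 = (\<lambda>e\<in>edges (S1 \<union> S2).
     if e \<in> edges S1 then \<mu>1 e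
     else if e \<in> edges S2 then \<mu>2 e
     else (i, the_elem (e \<inter> S1), the_elem (e \<inter> S2)))"

lemma graph_box_restrict_left:
  assumes "\<mu>1 \<in> G_objs n S1"
  shows "restrict (graph_box S1 S2 i \<mu>1 \<mu>2) (edges S1) = \<mu>1"
proof
  fix e
  have "e \<in> edges S1 \<Longrightarrow> e \<in> edges (S1 \<union> S2)"
    by (auto simp: edges_def)
  then show "restrict (graph_box S1 S2 i \<mu>1 \<mu>2) (edges S1) e = \<mu>1 e"
    using assms by (cases "e \<in> edges S1") (auto simp: graph_box_def G_objs_def extensional_def)
qed

lemma graph_box_restrict_right:
  assumes "S1 \<inter> S2 = {}" "\<mu>2 \<in> G_objs n S2"
  shows "restrict (graph_box S1 S2 i \<mu>1 \<mu>2) (edges S2) = \<mu>2"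
proof
  fix e
  have "e \<in> edges S2 \<Longrightarrow> e \<in> edges (S1 \<union> S2) \<and> e \<notin> edges S1"
    using assms(1) by (auto simp: edges_def doubleton_eq_iff)
  then show "restrict (graph_box S1 S2 i \<mu>1 \<mu>2) (edges S2) e = \<mu>2 e"
    using assms by (cases "e \<in> edges S2") (auto simp: graph_box_def G_objs_def extensional_def)
qed

lemma graph_box_cross:
  assumes "S1 \<inter> S2 = {}" "x \<in> S1" "y \<in> S2"
  shows "graph_box S1 S2 i \<mu>1 \<mu>2 {x, y} = (i, x, y)"
proof -
  have "x \<noteq> y"
    using assms by blast
  then have "{x, y} \<in> edges (S1 \<union> S2)"
    using assms unfolding edges_def by blast
  moreover have "{x, y} \<notin> edges S1" "{x, y} \<notin> edges S2"
    using assms by (auto simp: edges_def doubleton_eq_iff)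
  moreover have "{x, y} \<inter> S1 = {x}" "{x, y} \<inter> S2 = {y}"
    using assms by auto
  ultimately show ?thesis
    by (simp add: graph_box_def)
qed

definition ordered_partition :: "'a set \<Rightarrow> 'a set \<Rightarrow> 'a set \<Rightarrow> bool" where
  "ordered_partition S S1 S2 \<longleftrightarrow>
     S1 \<noteq> {} \<and> S2 \<noteq> {} \<and> S1 \<inter> S2 = {} \<and> S1 \<union> S2 = S"

text \<open>\<open>(\<lambda>_. undefined)\<close> is the unique object over a set with at most one element. Recursion on
  the cardinality of the finite set \<open>S\<close> becomes an inductive definition, since both parts of an
  ordered partition are smaller.\<close>

inductive M_up :: "nat \<Rightarrow> 'a set \<Rightarrow> 'a graph_obj \<Rightarrow> bool" where
  M_up_small: "finite S \<Longrightarrow> card S \<le> 1 \<Longrightarrow> M_up n S (\<lambda>_. undefined)"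
| M_up_box: "finite S \<Longrightarrow> ordered_partition S S1 S2 \<Longrightarrow> 1 \<le> i \<Longrightarrow> i \<le> n \<Longrightarrow>
     M_up i S1 \<mu>1 \<Longrightarrow> M_up i S2 \<mu>2 \<Longrightarrow> M_up n S (graph_box S1 S2 i \<mu>1 \<mu>2)"

inductive M_down :: "nat \<Rightarrow> 'a set \<Rightarrow> 'a graph_obj \<Rightarrow> bool" for n :: nat where
  M_down_small: "finite S \<Longrightarrow> card S \<le> 1 \<Longrightarrow> M_down n S (\<lambda>_. undefined)"
| M_down_box: "finite S \<Longrightarrow> ordered_partition S S1 S2 \<Longrightarrow> 1 \<le> i \<Longrightarrow> i \<le> n \<Longrightarrow>
     M_down n S1 \<mu>1 \<Longrightarrow> \<forall>e\<in>edges S1. lab \<mu>1 e \<in> {i..n} \<Longrightarrow>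
     M_down n S2 \<mu>2 \<Longrightarrow> \<forall>e\<in>edges S2. lab \<mu>2 e \<in> {i..n} \<Longrightarrow>
     M_down n S (graph_box S1 S2 i \<mu>1 \<mu>2)"

definition M_up_objs :: "nat \<Rightarrow> 'a set \<Rightarrow> 'a graph_obj set" where
  "M_up_objs n S = {\<mu>. M_up n S \<mu>}"

definition M_down_objs :: "nat \<Rightarrow> 'a set \<Rightarrow> 'a graph_obj set" where
  "M_down_objs n S = {\<mu>. M_down n S \<mu>}"

end

theory Submission
  imports Defs
begin

text \<open>By Quillen's fibre lemma for inclusions of finite posets it suffices that
  \<open>{\<mu> \<in> M_down. \<mu> \<le> b}\<close> is contractible for every \<open>b\<close> without monochromatic cycles; the
  statement about \<open>M_up\<close> follows by reversing the order of the labels. Let \<open>m\<close> be a lower bound of the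
  labels of \<open>b\<close>. Sending \<open>\<mu>\<close> to the set of vertices without incoming edges of label \<open>m\<close> is a monotone
  map to the nonempty sets of such vertices of \<open>b\<close>, a poset with a largest element because \<open>b\<close> has no
  cycles of label \<open>m\<close>. The fibre of the objects whose sources contain \<open>T\<close> is equivalent to a product
  of two smaller instances, on \<open>T\<close> with labels above \<open>m\<close> and on \<open>S - T\<close>, through the box product
  at label \<open>m\<close>; for \<open>T = S\<close> it is the same poset with the bound \<open>m + 1\<close>.

  Quillen's lemma for finite posets reduces to one geometric fact: adding a point to a poset does not
  affect contractibility if the elements below it (or above it) form a contractible poset.\<close>

section \<open>Flag realizations\<close>

text \<open>The lower bound \<open>m\<close> on the labels is what makes sources behave well. Going
  down in the order cannot change an edge whose label is already the least allowed one, so an edge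
  of label \<open>m\<close> in a larger object is present in every smaller one, and sets of sources
  grow upwards. If \<open>x\<close> is a source, \<open>(m, x, y)\<close> lies below every value
  that the edge to \<open>y\<close> may still have; hence boxing at \<open>m\<close> is the least
  way to combine an object on \<open>T\<close> with one on \<open>S - T\<close> among those with
  \<open>T\<close> in the sources. Inside \<open>T\<close> the bound then rises to
  \<open>m + 1\<close>, in accordance with the condition on labels in \<open>M_down\<close>. Only
  contractibility is transferred, always as an equivalence between two posets. This is why adding
  single points suffices for Quillen's lemma: both posets sit in a mapping cylinder, from which
  either copy is removed point by point. Posets are realized by barycentric coordinates in a
  function space; as they are finite, the product topology is the right one and all homotopies are
  explicit formulas. The quotient built from the nerve enters only through a comparison map.\<close>

definition flag_realization :: "('a \<Rightarrow> 'a \<Rightarrow> bool) \<Rightarrow> 'a set \<Rightarrow> ('a \<Rightarrow> real) set" where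
  "flag_realization C X =
     {t. (\<forall>x. 0 \<le> t x) \<and> (\<forall>x. t x \<noteq> 0 \<longrightarrow> x \<in> X) \<and> sum t X = 1 \<and>
         (\<forall>x y. t x \<noteq> 0 \<longrightarrow> t y \<noteq> 0 \<longrightarrow> C x y)}"

lemma flag_realizationD:
  assumes "t \<in> flag_realization C X"
  shows "0 \<le> t x" "x \<notin> X \<Longrightarrow> t x = 0" "sum t X = 1" "t x \<noteq> 0 \<Longrightarrow> t y \<noteq> 0 \<Longrightarrow> C x y"
    "t x \<noteq> 0 \<Longrightarrow> x \<in> X"
  using assms unfolding flag_realization_def by auto

lemma flag_realization_le_1:
  assumes "finite X" "t \<in> flag_realization C X"
  shows "t x \<le> 1"
proof (cases "x \<in> X")
  case True
  then have "t x \<le> sum t X"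
    using assms flag_realizationD(1)[OF assms(2)] by (intro member_le_sum) auto
  then show ?thesis using flag_realizationD(3)[OF assms(2)] by simp
next
  case False
  then show ?thesis using flag_realizationD(2)[OF assms(2)] by simp
qed

lemma continuous_on_coordinate: "continuous_on S (\<lambda>t :: 'a \<Rightarrow> real. t x)"
  by (rule continuous_on_product_then_coordinatewise[OF continuous_on_id])

text \<open>Meant for a weight times normalized coordinates: the second factor has no limit where
  the weight vanishes, but it is bounded, so the product tends to zero there.\<close>

lemma continuous_on_mult_bounded:
  fixes a w :: "'a::topological_space \<Rightarrow> real"
  assumes a: "continuous_on S a" and w: "continuous_on {z \<in> S. a z \<noteq> 0} w"
    and bd: "\<And>z. z \<in> S \<Longrightarrow> a z \<noteq> 0 \<Longrightarrow> \<bar>w z\<bar> \<le> 1"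
  shows "continuous_on S (\<lambda>z. a z * w z)"
  unfolding continuous_on_def
proof
  fix z assume z: "z \<in> S"
  have le: "\<bar>a y * w y\<bar> \<le> \<bar>a y\<bar>" if "y \<in> S" for y
    using bd[OF that] by (cases "a y = 0") (auto simp: abs_mult mult_left_le)
  show "((\<lambda>z. a z * w z) \<longlongrightarrow> a z * w z) (at z within S)"
  proof (cases "a z = 0")
    case True
    have "((\<lambda>y. \<bar>a y\<bar>) \<longlongrightarrow> 0) (at z within S)"
      using a z True by (metis continuous_on_def tendsto_rabs_zero_iff)
    then have "((\<lambda>y. a y * w y) \<longlongrightarrow> 0) (at z within S)"
      by (rule Lim_null_comparison[rotated]) (auto simp: eventually_at_filter le)
    then show ?thesis using True by simp
  next
    case False
    have op: "openin (top_of_set S) {y \<in> S. a y \<noteq> 0}"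
      using continuous_openin_preimage_gen[OF a, of "- {0}"]
      by (simp add: open_Compl vimage_def Int_def)
    have "continuous_on {y \<in> S. a y \<noteq> 0} (\<lambda>z. a z * w z)"
      by (intro continuous_intros w continuous_on_subset[OF a]) auto
    then have "((\<lambda>z. a z * w z) \<longlongrightarrow> a z * w z) (at z within {y \<in> S. a y \<noteq> 0})"
      using z False by (simp add: continuous_on_def)
    moreover have "at z within {y \<in> S. a y \<noteq> 0} = at z within S"
    proof -
      obtain T where T: "open T" "{y \<in> S. a y \<noteq> 0} = S \<inter> T"
        using op by (auto simp: openin_open)
      then show ?thesis using z False by (intro at_within_nhd[of z T]) auto
    qed
    ultimately show ?thesis by simp
  qed
qed

text \<open>The straight-line homotopy works: if the support of \<open>f t\<close> is contained in
  that of \<open>g t\<close>, every point of the segment is supported on the clique belonging to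
  \<open>g t\<close>.\<close>

lemma homotopic_flag_realization:
  assumes f: "continuous_on T f" "f \<in> T \<rightarrow> flag_realization C X"
    and g: "continuous_on T g" "g \<in> T \<rightarrow> flag_realization C X"
    and sup: "\<And>t x. t \<in> T \<Longrightarrow> f t x \<noteq> 0 \<Longrightarrow> g t x \<noteq> 0"
  shows "homotopic_with_canon (\<lambda>_. True) T (flag_realization C X) f g"
proof -
  let ?h = "\<lambda>z x. (1 - fst z) * f (snd z) x + fst z * g (snd z) x"
  have "continuous_on ({0..1} \<times> T) (\<lambda>z. f (snd z) x)" "continuous_on ({0..1} \<times> T) (\<lambda>z. g (snd z) x)"
    for x
    by (rule continuous_on_compose2[OF continuous_on_product_then_coordinatewise[OF f(1)]]
          continuous_on_compose2[OF continuous_on_product_then_coordinatewise[OF g(1)]];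
        auto intro: continuous_intros)+
  then have "continuous_on ({0..1} \<times> T) ?h"
    by (intro continuous_intros)
  moreover have "?h z \<in> flag_realization C X" if "z \<in> {0..1} \<times> T" for z
  proof -
    let ?s = "fst z" and ?t = "snd z"
    have s: "0 \<le> ?s" "?s \<le> 1" and t: "?t \<in> T" using that by auto
    note F = flag_realizationD[OF funcset_mem[OF f(2) t]]
    note G = flag_realizationD[OF funcset_mem[OF g(2) t]]
    have supp: "g ?t x \<noteq> 0" if "?h z x \<noteq> 0" for x
      using that sup[OF t, of x] by auto
    have "sum (?h z) X = 1"
      by (simp add: sum.distrib sum_distrib_left[symmetric] F(3) G(3))
    then show ?thesis
      unfolding flag_realization_def
      using s F(1) G(1) G(4,5)[OF supp] G(4)[OF supp supp] by (auto intro!: add_nonneg_nonneg mult_nonneg_nonneg)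
  qed
  ultimately show ?thesis
    unfolding homotopic_with_def
    by (intro exI[of _ ?h]) (auto simp: continuous_map_subtopology_eu)
qed

section \<open>Attaching a cone to a flag realization\<close>

text \<open>\<open>C_link\<close> makes the link of \<open>p\<close> the join of \<open>U\<close>
  with the other neighbours of \<open>p\<close>. A join with a contractible factor is contractible,
  so a contraction \<open>h\<close> of \<open>U\<close> to a point \<open>c\<close> is all that is
  required to attach the cone over the link.\<close>

locale cone_attachment =
  fixes C :: "'a \<Rightarrow> 'a \<Rightarrow> bool" and X U :: "'a set" and p :: 'a
    and h :: "real \<times> ('a \<Rightarrow> real) \<Rightarrow> 'a \<Rightarrow> real" and c :: "'a \<Rightarrow> real"
  assumes fin: "finite X" and p: "p \<notin> X" and U: "U \<subseteq> X"
    and C_sym: "C x y \<Longrightarrow> C y x"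
    and C_U: "u \<in> U \<Longrightarrow> C u p"
    and C_link: "u \<in> U \<Longrightarrow> x \<in> X \<Longrightarrow> x \<notin> U \<Longrightarrow> C x p \<Longrightarrow> C u x"
    and h_cont: "continuous_on ({0..1} \<times> flag_realization C U) h"
    and h_in: "z \<in> {0..1} \<times> flag_realization C U \<Longrightarrow> h z \<in> flag_realization C U"
    and h_0: "h (0, t) = t" and h_1: "h (1, t) = c" and c_in: "c \<in> flag_realization C U"
begin

abbreviation "L \<equiv> flag_realization C X"
abbreviation "K \<equiv> flag_realization C (insert p X)"

definition mass :: "('a \<Rightarrow> real) \<Rightarrow> real" where
  "mass t = t p + sum t U"

text \<open>Division by zero is harmless here and in \<open>base\<close>: if
  \<open>mass t = 0\<close>, the result only enters \<open>push\<close> with the factor 0, and if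
  just \<open>sum t U = 0\<close>, then the height is 1, where \<open>slide\<close> is the constant
  \<open>c\<close>.\<close>

definition height :: "('a \<Rightarrow> real) \<Rightarrow> real" where
  "height t = t p / mass t"

text \<open>The factor 3 lets the weight at \<open>p\<close> exhaust \<open>mass t\<close> from
  height 1/3 on. The parameter \<open>3 * height t - 1\<close> in \<open>slide\<close> leaves 0 at
  the same height and reaches 1 at height 2/3, so \<open>slide\<close> differs from
  \<open>base\<close> only where \<open>lift\<close> has taken all the weight.\<close>

definition lift :: "('a \<Rightarrow> real) \<Rightarrow> real" where
  "lift t = min (mass t) (3 * t p)"

definition base :: "('a \<Rightarrow> real) \<Rightarrow> 'a \<Rightarrow> real" where
  "base t = (\<lambda>x. if x \<in> U then t x / sum t U else 0)"

definition slide :: "('a \<Rightarrow> real) \<Rightarrow> 'a \<Rightarrow> real" where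
  "slide t = (if height t \<le> 2/3 then h (max 0 (min 1 (3 * height t - 1)), base t) else c)"

text \<open>A point \<open>t\<close> of the star of \<open>p\<close> has height \<open>t p / mass t\<close> in the cone over \<open>U\<close>. For \<open>s = 0\<close>
  its part in \<open>U \<union> {p}\<close> is replaced by a point of \<open>U\<close>, moved along the contraction of \<open>U\<close>; since the
  contraction is finished at height \<open>2/3\<close>, this makes sense at the apex. For \<open>s = 1\<close> all
  points above height \<open>1/3\<close> are pushed to the apex, so that the contraction becomes invisible.\<close>

definition push :: "real \<Rightarrow> ('a \<Rightarrow> real) \<Rightarrow> 'a \<Rightarrow> real" where
  "push s t = (\<lambda>x. if x = p then s * lift t
     else if x \<in> U then (mass t - s * lift t) * slide t x else t x)"

lemma finU: "finite U" and pU: "p \<notin> U"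
  using fin U p finite_subset by auto

lemma L_sub_K: "L \<subseteq> K"
proof
  fix t assume t: "t \<in> L"
  then have "t p = 0" using flag_realizationD(2)[OF t] p by simp
  then have "sum t (insert p X) = 1" using flag_realizationD(3)[OF t] fin p by simp
  then show "t \<in> K" using t unfolding flag_realization_def by auto
qed

lemma sum_U_nonneg: "t \<in> K \<Longrightarrow> 0 \<le> sum t U"
  by (simp add: sum_nonneg flag_realizationD(1))

lemma mass_nonneg: "t \<in> K \<Longrightarrow> 0 \<le> mass t"
  using sum_U_nonneg flag_realizationD(1)[of t C "insert p X" p] by (simp add: mass_def)

lemma lift_bounds:
  assumes "t \<in> K"
  shows "0 \<le> lift t" "lift t \<le> mass t"
  using mass_nonneg[OF assms] flag_realizationD(1)[OF assms, of p] by (auto simp: lift_def)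

lemma mass_0:
  assumes "t \<in> K" "mass t = 0"
  shows "t p = 0" "u \<in> U \<Longrightarrow> t u = 0"
proof -
  note n = flag_realizationD(1)[OF assms(1)]
  have z: "t p = 0" "sum t U = 0"
    using assms(2) n[of p] sum_U_nonneg[OF assms(1)] unfolding mass_def by linarith+
  then show "t p = 0" "u \<in> U \<Longrightarrow> t u = 0"
    using n finU by (auto simp: sum_nonneg_eq_0_iff)
qed

lemma base_in:
  assumes t: "t \<in> K" and pos: "sum t U > 0"
  shows "base t \<in> flag_realization C U"
proof -
  have "sum (base t) U = 1"
    using pos by (simp add: base_def sum_divide_distrib[symmetric])
  then show ?thesis
    using flag_realizationD(1,4)[OF t] pos unfolding flag_realization_def base_def by auto
qed

lemma height_le:
  assumes t: "t \<in> K" and m: "mass t > 0" and "height t \<le> 2/3"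
  shows "sum t U > 0"
proof (rule ccontr)
  assume "\<not> ?thesis"
  then have "sum t U = 0" using sum_U_nonneg[OF t] by simp
  then have "height t = 1" using m by (simp add: height_def mass_def)
  then show False using assms(3) by simp
qed

lemma slide_in:
  assumes t: "t \<in> K" and m: "mass t > 0"
  shows "slide t \<in> flag_realization C U"
  using height_le[OF assms] h_in base_in[OF t] c_in by (auto simp: slide_def)

lemma slide_low:
  assumes t: "t \<in> K" and m: "mass t > 0" and "3 * t p \<le> mass t"
  shows "slide t = base t"
proof -
  have "height t \<le> 1/3" using m assms(3) by (simp add: height_def field_simps)
  then have "height t \<le> 2/3" "max 0 (min 1 (3 * height t - 1)) = 0" by auto
  then show ?thesis by (simp add: slide_def h_0)
qed

lemma mass_slide:
  assumes t: "t \<in> K" and "3 * t p < mass t" and x: "x \<in> U"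
  shows "(mass t - lift t) * slide t x = t x * (mass t - lift t) / sum t U" "sum t U > 0"
proof -
  have m: "mass t > 0" using assms(2) flag_realizationD(1)[OF t, of p] by linarith
  show "(mass t - lift t) * slide t x = t x * (mass t - lift t) / sum t U"
    using slide_low[OF t m] assms by (simp add: base_def)
  show "sum t U > 0" using assms(2) flag_realizationD(1)[OF t, of p] by (simp add: mass_def)
qed

lemma continuous_mass: "continuous_on S mass"
  unfolding mass_def by (intro continuous_intros continuous_on_coordinate)

lemma continuous_lift: "continuous_on S lift"
  unfolding lift_def by (intro continuous_intros continuous_on_coordinate continuous_mass)

lemma continuous_height: "continuous_on {t \<in> K. mass t > 0} height"
  unfolding height_def by (intro continuous_intros continuous_on_coordinate continuous_mass) auto

text \<open>Two closed pieces meet at height 2/3, where the contraction has arrived at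
  \<open>c\<close>. The projection \<open>base\<close> is continuous on the lower piece but breaks
  down at the apex, which lies in the upper one.\<close>

lemma continuous_slide: "continuous_on {t \<in> K. mass t > 0} slide"
proof -
  let ?S = "{t \<in> K. mass t > 0}"
  let ?l = "\<lambda>t. h (max 0 (min 1 (3 * height t - 1)), base t)"
  let ?A = "{t \<in> ?S. height t \<le> 2/3}" and ?B = "{t \<in> ?S. height t \<ge> 2/3}"
  have sub: "continuous_on T height" if "T \<subseteq> ?S" for T
    using continuous_height that continuous_on_subset by blast
  have A: "continuous_on ?A ?l"
  proof (rule continuous_on_compose2[OF h_cont])
    have "continuous_on ?A (\<lambda>t. base t x)" for x
    proof (cases "x \<in> U")
      case True
      have "\<forall>t\<in>?A. sum t U \<noteq> 0" using height_le by force
      then show ?thesis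
        using True by (auto simp: base_def intro!: continuous_intros continuous_on_coordinate)
    qed (simp add: base_def)
    then have "continuous_on ?A base"
      by (rule continuous_on_coordinatewise_then_product)
    moreover have "continuous_on ?A (\<lambda>t. max 0 (min 1 (3 * height t - 1)))"
      by (intro continuous_intros sub) auto
    ultimately show "continuous_on ?A (\<lambda>t. (max 0 (min 1 (3 * height t - 1)), base t))"
      by (rule continuous_on_Pair[rotated])
    show "(\<lambda>t. (max 0 (min 1 (3 * height t - 1)), base t)) ` ?A \<subseteq> {0..1} \<times> flag_realization C U"
      using height_le base_in by auto
  qed
  have "continuous_on (?A \<union> ?B) (\<lambda>t. if height t \<le> 2/3 then ?l t else c)"
  proof (rule continuous_on_cases_local)
    show "closedin (top_of_set (?A \<union> ?B)) ?A" "closedin (top_of_set (?A \<union> ?B)) ?B"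
    proof -
      have eq: "?A \<union> ?B = ?S" by auto
      have "closedin (top_of_set ?S) (?S \<inter> height -` {..2/3})"
        "closedin (top_of_set ?S) (?S \<inter> height -` {2/3..})"
        by (intro continuous_closedin_preimage continuous_height; simp)+
      moreover have "?S \<inter> height -` {..2/3} = ?A" "?S \<inter> height -` {2/3..} = ?B" by auto
      ultimately show "closedin (top_of_set (?A \<union> ?B)) ?A" "closedin (top_of_set (?A \<union> ?B)) ?B"
        unfolding eq by simp_all
    qed
    show "continuous_on ?A ?l" by (rule A)
    show "continuous_on ?B (\<lambda>t. c)" by simp
    show "?l t = c" if "t \<in> ?A \<and> \<not> height t \<le> 2/3 \<or> t \<in> ?B \<and> height t \<le> 2/3" for t
    proof -
      have "height t = 2/3" using that by auto
      then show ?thesis by (simp add: h_1)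
    qed
  qed
  moreover have "?A \<union> ?B = ?S" by auto
  ultimately show ?thesis unfolding slide_def by simp
qed

lemma push_in:
  assumes t: "t \<in> K" and s: "0 \<le> s" "s \<le> 1"
  shows "push s t \<in> K"
proof (cases "mass t = 0")
  case True
  have "push s t = t"
    using mass_0[OF t True] lift_bounds[OF t] True by (auto simp: push_def)
  then show ?thesis using t by simp
next
  case False
  then have m: "mass t > 0" using mass_nonneg[OF t] by simp
  note T = flag_realizationD[OF t]
  note W = flag_realizationD[OF slide_in[OF t m]]
  have sl: "0 \<le> s * lift t" "s * lift t \<le> mass t"
    using s lift_bounds[OF t] by (auto intro: mult_left_le_one_le order_trans)
  have nn: "0 \<le> push s t x" for x
    using T(1) W(1) sl by (auto simp: push_def)
  have supp: "x \<in> insert p X" if "push s t x \<noteq> 0" for x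
    using that T(5) U by (auto simp: push_def split: if_splits)
  have sumU: "sum (push s t) U = mass t - s * lift t"
  proof -
    have "sum (push s t) U = (\<Sum>x\<in>U. (mass t - s * lift t) * slide t x)"
      by (rule sum.cong) (use pU in \<open>auto simp: push_def\<close>)
    then show ?thesis by (simp add: sum_distrib_left[symmetric] W(3))
  qed
  have "sum (push s t) (X - U) = sum t (X - U)"
    by (rule sum.cong) (use p in \<open>auto simp: push_def\<close>)
  moreover have "sum f X = sum f U + sum f (X - U)" for f :: "'a \<Rightarrow> real"
    using sum.subset_diff[OF U fin, of f] by simp
  ultimately have "sum (push s t) (insert p X) = sum t (insert p X)"
    using sumU fin p by (simp add: push_def mass_def)
  then have sum1: "sum (push s t) (insert p X) = 1" using T(3) by simp
  \<comment> \<open>\<open>slide\<close> may bring in vertices of \<open>U\<close> that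
    \<open>t\<close> does not use. This happens only for \<open>t p \<noteq> 0\<close>; then all
    vertices of \<open>t\<close> outside \<open>U\<close> are adjacent to \<open>p\<close>, hence by
    \<open>C_link\<close> to every vertex of \<open>U\<close>.\<close>
  have cl: "C x y" if x: "push s t x \<noteq> 0" and y: "push s t y \<noteq> 0" for x y
  proof (cases "t p = 0")
    case True
    then have "slide t = base t" "lift t = 0" "mass t = sum t U"
      using slide_low[OF t m] m by (auto simp: lift_def mass_def)
    then have "push s t = t"
      using m True by (auto simp: push_def base_def)
    then show ?thesis using x y T(4) by simp
  next
    case False
    have U2: "C x y" if "x \<in> U" "y \<in> U" "push s t x \<noteq> 0" "push s t y \<noteq> 0" for x y
      using that W(4) pU by (auto simp: push_def split: if_splits)
    have UV: "C x y" if "x \<in> U" "y \<notin> U" "push s t y \<noteq> 0" for x y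
    proof (cases "y = p")
      case False
      then have "t y \<noteq> 0" using that by (auto simp: push_def)
      then show ?thesis using T(4)[of y p] T(5)[of y] \<open>t p \<noteq> 0\<close> \<open>y \<noteq> p\<close> C_link that by auto
    qed (use C_U that in simp)
    have V: "C x y" if "x \<notin> U" "y \<notin> U" "push s t x \<noteq> 0" "push s t y \<noteq> 0" for x y
      using that T(4) False by (auto simp: push_def split: if_splits)
    show ?thesis using U2[of x y] UV[of x y] UV[of y x] V[of x y] C_sym x y by blast
  qed
  show ?thesis unfolding flag_realization_def mem_Collect_eq
    by (intro conjI allI impI nn supp sum1 cl)
qed

lemma push_0_in:
  assumes t: "t \<in> K"
  shows "push 0 t \<in> L"
proof -
  have K: "push 0 t \<in> K" using push_in[OF t] by simp
  have p0: "push 0 t p = 0" by (simp add: push_def)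
  have sum1: "sum (push 0 t) X = 1"
    using flag_realizationD(3)[OF K] p fin by (simp add: push_def)
  have supp: "x \<in> X" if "push 0 t x \<noteq> 0" for x
    using flag_realizationD(5)[OF K that] p0 that by auto
  show ?thesis unfolding flag_realization_def mem_Collect_eq
    by (intro conjI allI impI sum1 supp flag_realizationD(1)[OF K] flag_realizationD(4)[OF K])
qed

lemma push_0_L:
  assumes t: "t \<in> L"
  shows "push 0 t = t"
proof -
  have K: "t \<in> K" using t L_sub_K by auto
  have tp: "t p = 0" using flag_realizationD(2)[OF t] p by simp
  show ?thesis
  proof (cases "mass t = 0")
    case True
    then show ?thesis using mass_0[OF K] by (auto simp: push_def)
  next
    case False
    then have m: "mass t > 0" using mass_nonneg[OF K] by simp
    then have "slide t = base t" "mass t = sum t U"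
      using slide_low[OF K m] tp by (auto simp: mass_def)
    then show ?thesis using m tp by (auto simp: push_def base_def)
  qed
qed

lemma continuous_push: "continuous_on ({0..1} \<times> K) (\<lambda>z. push (fst z) (snd z))"
proof (rule continuous_on_coordinatewise_then_product)
  fix x
  let ?Z = "{0..1} \<times> K"
  have c: "continuous_on S (\<lambda>z. f (snd z))" if "continuous_on UNIV f"
    for f :: "('a \<Rightarrow> real) \<Rightarrow> real" and S :: "(real \<times> ('a \<Rightarrow> real)) set"
    by (rule continuous_on_compose2[OF that]) (auto intro: continuous_intros)
  have l: "continuous_on S (\<lambda>z. fst z * lift (snd z))" for S :: "(real \<times> ('a \<Rightarrow> real)) set"
    by (intro continuous_intros c continuous_lift)
  consider "x = p" | "x \<noteq> p" "x \<in> U" | "x \<noteq> p" "x \<notin> U" by blast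
  then show "continuous_on ?Z (\<lambda>z. push (fst z) (snd z) x)"
  proof cases
    case 1 then show ?thesis by (simp add: push_def l)
  next
    case 2
    let ?a = "\<lambda>z. mass (snd z) - fst z * lift (snd z)"
    have pos: "mass (snd z) > 0" if "z \<in> ?Z" "?a z \<noteq> 0" for z
    proof -
      have "mass (snd z) \<noteq> 0"
      proof
        assume "mass (snd z) = 0"
        moreover have "lift (snd z) = 0"
          using lift_bounds[of "snd z"] calculation that(1) by auto
        ultimately show False using that(2) by simp
      qed
      then show ?thesis using mass_nonneg[of "snd z"] that(1) by auto
    qed
    have "continuous_on ?Z (\<lambda>z. ?a z * slide (snd z) x)"
    proof (rule continuous_on_mult_bounded)
      show "continuous_on ?Z ?a"
        by (intro continuous_intros l c continuous_mass)
      show "continuous_on {z \<in> ?Z. ?a z \<noteq> 0} (\<lambda>z. slide (snd z) x)"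
        by (rule continuous_on_compose2[OF continuous_on_product_then_coordinatewise[OF continuous_slide]])
          (use pos in \<open>auto intro: continuous_intros\<close>)
      show "\<bar>slide (snd z) x\<bar> \<le> 1" if "z \<in> ?Z" "?a z \<noteq> 0" for z
      proof -
        have "slide (snd z) \<in> flag_realization C U"
          using slide_in[of "snd z"] pos[OF that] that(1) by auto
        then show ?thesis
          using flag_realizationD(1) flag_realization_le_1[OF finU] by (metis abs_of_nonneg)
      qed
    qed
    then show ?thesis using 2 by (simp add: push_def)
  next
    case 3 then show ?thesis by (simp add: push_def c[OF continuous_on_coordinate])
  qed
qed

lemma continuous_push_at:
  assumes "0 \<le> s" "s \<le> 1"
  shows "continuous_on K (push s)"
proof -
  have "(\<lambda>t. (s, t)) ` K \<subseteq> {0..1} \<times> K" using assms by auto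
  with continuous_on_compose2[OF continuous_push continuous_on_Pair[OF continuous_on_const continuous_on_id]]
  show ?thesis by fastforce
qed

section \<open>Retraction onto the smaller realization and transfer of contractibility\<close>

lemma push_homotopic:
  "homotopic_with_canon (\<lambda>_. True) K K (push 0) (push 1)"
  unfolding homotopic_with_def
  by (intro exI[of _ "\<lambda>z. push (fst z) (snd z)"])
    (use continuous_push push_in in \<open>simp add: continuous_map_subtopology_eu Pi_iff\<close>)

text \<open>Below height 1/3 \<open>slide\<close> is \<open>base\<close>, and from that height on no
  weight is left on \<open>U\<close>. So \<open>push 1 t\<close> uses no vertex that
  \<open>t\<close> does not use, and the segment between them stays in one simplex.\<close>

lemma push_1_homotopic:
  "homotopic_with_canon (\<lambda>_. True) K K (push 1) id"
proof (rule homotopic_flag_realization)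
  show "continuous_on K (push 1)" "push 1 \<in> K \<rightarrow> K" "continuous_on K id" "id \<in> K \<rightarrow> K"
    using continuous_push_at[of 1] push_in by (auto simp: continuous_on_id')
  fix t x assume t: "t \<in> K" and x: "push 1 t x \<noteq> 0"
  show "id t x \<noteq> 0"
  proof (cases "x = p")
    case True
    then have "lift t \<noteq> 0" using x by (simp add: push_def)
    then show ?thesis using True mass_nonneg[OF t] by (auto simp: lift_def)
  next
    case np: False
    show ?thesis
    proof (cases "x \<in> U")
      case True
      then have "mass t - lift t \<noteq> 0" "(mass t - lift t) * slide t x \<noteq> 0" using x np by (auto simp: push_def)
      moreover from this have "3 * t p < mass t" by (auto simp: lift_def min_def split: if_splits)
      ultimately show ?thesis using mass_slide[OF t _ True] by auto
    qed (use x np in \<open>simp add: push_def\<close>)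
  qed
qed

lemma contractible_remove: "contractible K \<Longrightarrow> contractible L"
proof -
  assume "contractible K"
  moreover have "retraction_map (top_of_set K) (top_of_set L) (push 0)"
    unfolding retraction_map_def retraction_maps_def
    using continuous_push_at[of 0] push_0_in push_0_L L_sub_K
    by (intro exI[of _ id]) (auto simp: continuous_map_subtopology_eu continuous_on_id')
  ultimately show ?thesis
    using contractible_space_retraction_map_image contractible_space_top_of_set by metis
qed

text \<open>The identity is homotopic to \<open>push 0\<close> by way of \<open>push 1\<close>, and
  \<open>push 0\<close> factors through the contractible \<open>L\<close>.\<close>

lemma contractible_add:
  assumes "contractible L"
  shows "contractible K"
proof -
  have "continuous_on K (push 0)" "push 0 \<in> K \<rightarrow> L" "continuous_on L id" "id \<in> L \<rightarrow> K"
    using continuous_push_at[of 0] push_0_in L_sub_K by (auto simp: continuous_on_id')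
  from nullhomotopic_through_contractible[OF this assms]
  obtain d where "homotopic_with_canon (\<lambda>_. True) K K (id \<circ> push 0) (\<lambda>x. d)" .
  then have "homotopic_with_canon (\<lambda>_. True) K K (push 0) (\<lambda>x. d)" by simp
  then have "homotopic_with_canon (\<lambda>_. True) K K id (\<lambda>x. d)"
    by (rule homotopic_with_trans[OF homotopic_with_symD[OF push_1_homotopic]
          homotopic_with_trans[OF homotopic_with_symD[OF push_homotopic]]])
  then show ?thesis unfolding contractible_def by blast
qed

end

theorem contractible_insert_iff:
  assumes fin: "finite X" and p: "p \<notin> X" and U: "U \<subseteq> X"
    and sym: "\<And>x y. C x y \<Longrightarrow> C y x" and CU: "\<And>u. u \<in> U \<Longrightarrow> C u p"
    and link: "\<And>u x. u \<in> U \<Longrightarrow> x \<in> X \<Longrightarrow> x \<notin> U \<Longrightarrow> C x p \<Longrightarrow> C u x"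
    and con: "contractible (flag_realization C U)" and ne: "flag_realization C U \<noteq> {}"
  shows "contractible (flag_realization C (insert p X)) \<longleftrightarrow> contractible (flag_realization C X)"
proof -
  obtain c where c: "homotopic_with_canon (\<lambda>_. True) (flag_realization C U) (flag_realization C U) id (\<lambda>x. c)"
    using con by (auto simp: contractible_def)
  \<comment> \<open>\<open>c\<close> is the value of a constant self-map of
    \<open>flag_realization C U\<close>, so it lies in that set once there is a point to evaluate
    at.\<close>
  then have "c \<in> flag_realization C U"
    using ne homotopic_with_imp_funspace2 by fastforce
  moreover obtain h :: "real \<times> ('a \<Rightarrow> real) \<Rightarrow> 'a \<Rightarrow> real" where "continuous_on ({0..1} \<times> flag_realization C U) h"
    "\<And>z. z \<in> {0..1} \<times> flag_realization C U \<Longrightarrow> h z \<in> flag_realization C U"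
    "\<And>t. h (0, t) = t" "\<And>t. h (1, t) = c"
    using c unfolding homotopic_with_def by (auto simp: Pi_iff)
  ultimately interpret cone_attachment C X U p h c
    using assms by unfold_locales auto
  show ?thesis using contractible_remove contractible_add by blast
qed

section \<open>Contractibility of finite posets\<close>

definition comparable :: "('a \<Rightarrow> 'a \<Rightarrow> bool) \<Rightarrow> 'a \<Rightarrow> 'a \<Rightarrow> bool" where
  "comparable R x y \<longleftrightarrow> R x y \<or> R y x"

definition poset_on :: "'a set \<Rightarrow> ('a \<Rightarrow> 'a \<Rightarrow> bool) \<Rightarrow> bool" where
  "poset_on X R \<longleftrightarrow> reflp_on X R \<and> antisymp_on X R \<and> transp_on X R"

text \<open>\<open>contractible\<close> holds for the empty set; nonemptiness is added to match
  \<open>has_contractible_realization\<close>.\<close>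

definition contractible_poset :: "('a \<Rightarrow> 'a \<Rightarrow> bool) \<Rightarrow> 'a set \<Rightarrow> bool" where
  "contractible_poset R X \<longleftrightarrow>
     finite X \<and> X \<noteq> {} \<and> contractible (flag_realization (comparable R) X)"

lemma poset_onD:
  assumes "poset_on X R"
  shows "x \<in> X \<Longrightarrow> R x x"
    and "x \<in> X \<Longrightarrow> y \<in> X \<Longrightarrow> R x y \<Longrightarrow> R y x \<Longrightarrow> x = y"
    and "x \<in> X \<Longrightarrow> y \<in> X \<Longrightarrow> z \<in> X \<Longrightarrow> R x y \<Longrightarrow> R y z \<Longrightarrow> R x z"
  using assms transp_onD[of X R x y z]
  by (simp_all add: poset_on_def reflp_on_def antisymp_on_def)

lemma poset_on_subset: "poset_on X R \<Longrightarrow> Y \<subseteq> X \<Longrightarrow> poset_on Y R"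
  using reflp_on_subset[of X R Y] antisymp_on_subset[of X R Y] transp_on_subset[of X R Y]
  by (simp add: poset_on_def)

lemma poset_on_conversep: "poset_on X R\<inverse>\<inverse> \<longleftrightarrow> poset_on X R"
  by (simp add: poset_on_def)

lemma contractible_poset_conversep: "contractible_poset R\<inverse>\<inverse> X \<longleftrightarrow> contractible_poset R X"
proof -
  have "comparable R\<inverse>\<inverse> = comparable R" by (auto simp: comparable_def fun_eq_iff)
  then show ?thesis by (simp add: contractible_poset_def)
qed

lemma vertex_in_flag_realization:
  assumes "finite X" "x \<in> X" "C x x"
  shows "(\<lambda>y. if y = x then 1 else 0) \<in> flag_realization C X"
  using assms unfolding flag_realization_def by auto

lemma contractible_poset_singleton:
  assumes "R x x"
  shows "contractible_poset R {x}"
proof -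
  have "flag_realization (comparable R) {x} = {\<lambda>y. if y = x then 1 else 0}"
  proof (intro equalityI subsetI)
    fix t assume t: "t \<in> flag_realization (comparable R) {x}"
    show "t \<in> {\<lambda>y. if y = x then 1 else 0}"
      using flag_realizationD(2,3)[OF t] by (auto simp: fun_eq_iff)
  qed (use assms vertex_in_flag_realization[of "{x}" x "comparable R"] in \<open>simp add: comparable_def\<close>)
  moreover have "contractible {\<lambda>y. if y = x then (1::real) else 0}"
    by (subst contractible_space_top_of_set[symmetric]) (rule contractible_space_subtopology_singleton)
  ultimately show ?thesis by (simp add: contractible_poset_def)
qed

text \<open>Everything below \<open>p\<close> is below everything above \<open>p\<close>, so the
  link of \<open>p\<close> is a join and \<open>U\<close> can be taken to be its lower half.\<close>

lemma contractible_poset_insert_lower: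
  assumes po: "poset_on (insert p X) R" and fin: "finite X" and p: "p \<notin> X"
    and U: "contractible_poset R {x \<in> X. R x p}"
  shows "contractible_poset R (insert p X) \<longleftrightarrow> contractible_poset R X"
proof -
  let ?U = "{x \<in> X. R x p}" and ?C = "comparable R"
  obtain u where u: "u \<in> ?U" using U by (auto simp: contractible_poset_def)
  have "contractible (flag_realization ?C (insert p X)) \<longleftrightarrow> contractible (flag_realization ?C X)"
  proof (rule contractible_insert_iff)
    show "?C u x" if "u \<in> ?U" "x \<in> X" "x \<notin> ?U" "?C x p" for u x
      using that poset_onD(3)[OF po, of u p x] by (auto simp: comparable_def)
    have "?C u u" using u poset_onD(1)[OF po] by (auto simp: comparable_def)
    then show "flag_realization ?C ?U \<noteq> {}"
      using vertex_in_flag_realization[of ?U u ?C] fin u by auto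
    show "contractible (flag_realization ?C ?U)" using U by (simp add: contractible_poset_def)
  qed (use fin p in \<open>auto simp: comparable_def\<close>)
  then show ?thesis using fin u by (auto simp: contractible_poset_def)
qed

lemma contractible_poset_insert_upper:
  assumes "poset_on (insert p X) R" "finite X" "p \<notin> X" "contractible_poset R {x \<in> X. R p x}"
  shows "contractible_poset R (insert p X) \<longleftrightarrow> contractible_poset R X"
  using contractible_poset_insert_lower[of p X "R\<inverse>\<inverse>"] assms
  by (simp add: poset_on_conversep contractible_poset_conversep)

section \<open>Removing points from a poset\<close>

lemma contractible_poset_top:
  assumes "poset_on X R" "finite X" "m \<in> X" "\<And>x. x \<in> X \<Longrightarrow> R x m"
  shows "contractible_poset R X"
  using assms(2,1,3,4)
proof (induction X rule: finite_psubset_induct)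
  case (psubset X)
  show ?case
  proof (cases "X = {m}")
    case True
    then show ?thesis using contractible_poset_singleton[of R m] psubset.prems by simp
  next
    case False
    then obtain x where x: "x \<in> X" "x \<noteq> m" using psubset.prems by auto
    let ?Y = "X - {x}"
    have sub: "contractible_poset R Z" if "Z \<subseteq> ?Y" "m \<in> Z" for Z
      by (rule psubset.IH) (use that x psubset.prems poset_on_subset in blast)+
    have "contractible_poset R ?Y" "contractible_poset R {y \<in> ?Y. R x y}"
      by (rule sub; use x psubset.prems in auto)+
    then show ?thesis
      using contractible_poset_insert_upper[of x ?Y R] x psubset.hyps psubset.prems(1)
      by (simp add: insert_absorb)
  qed
qed

lemma contractible_poset_bot:
  assumes "poset_on X R" "finite X" "m \<in> X" "\<And>x. x \<in> X \<Longrightarrow> R m x"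
  shows "contractible_poset R X"
  using contractible_poset_top[of X "R\<inverse>\<inverse>" m] assms
  by (simp add: poset_on_conversep contractible_poset_conversep)

lemma poset_on_minimal:
  assumes "poset_on X R" "finite X" "X \<noteq> {}"
  obtains m where "m \<in> X" "\<And>x. x \<in> X \<Longrightarrow> R x m \<Longrightarrow> x = m"
proof -
  have "asymp_on X (\<lambda>x y. R x y \<and> x \<noteq> y)" "transp_on X (\<lambda>x y. R x y \<and> x \<noteq> y)"
    using poset_onD[OF assms(1)] unfolding asymp_on_def transp_on_def by blast+
  then show ?thesis
    using Finite_Set.bex_min_element[OF assms(2) _ _ assms(3)] that by blast
qed

text \<open>The points of \<open>B - A\<close> are removed one at a time, minimal ones first.
  Everything strictly below the removed point then lies in \<open>A\<close>, so the lower half of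
  its link is exactly the fibre in the assumption, which does not change during the
  induction.\<close>

lemma contractible_poset_lower_fibres:
  assumes "poset_on B R" "finite B" "A \<subseteq> B"
    and "\<And>b. b \<in> B \<Longrightarrow> b \<notin> A \<Longrightarrow> contractible_poset R {a \<in> A. R a b}"
  shows "contractible_poset R B \<longleftrightarrow> contractible_poset R A"
  using assms(2,1,3,4)
proof (induction B rule: finite_psubset_induct)
  case (psubset B)
  show ?case
  proof (cases "B = A")
    case False
    have "poset_on (B - A) R" "finite (B - A)" "B - A \<noteq> {}"
      using psubset False poset_on_subset[of B R] by auto
    then obtain c where c: "c \<in> B - A" "\<And>x. x \<in> B - A \<Longrightarrow> R x c \<Longrightarrow> x = c"
      by (rule poset_on_minimal) blast
    let ?B = "B - {c}"
    have "{x \<in> ?B. R x c} = {a \<in> A. R a c}" using c psubset.prems(2) by auto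
    then have "contractible_poset R (insert c ?B) \<longleftrightarrow> contractible_poset R ?B"
      using c psubset.hyps psubset.prems(1,3)
      by (intro contractible_poset_insert_lower) (simp_all add: insert_absorb)
    also have "\<dots> \<longleftrightarrow> contractible_poset R A"
    proof (rule psubset.IH)
      show "poset_on ?B R" by (rule poset_on_subset[OF psubset.prems(1)]) simp
    qed (use c psubset.prems(2,3) in auto)
    finally show ?thesis using c by (simp add: insert_absorb)
  qed simp
qed

lemma contractible_poset_upper_fibres:
  assumes "poset_on B R" "finite B" "A \<subseteq> B"
    and "\<And>b. b \<in> B \<Longrightarrow> b \<notin> A \<Longrightarrow> contractible_poset R {a \<in> A. R b a}"
  shows "contractible_poset R B \<longleftrightarrow> contractible_poset R A"
  using contractible_poset_lower_fibres[of B "R\<inverse>\<inverse>" A] assms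
  by (simp add: poset_on_conversep contractible_poset_conversep)

section \<open>Transport along bijections and the fibre lemma\<close>

lemma homeomorphic_flag_realization:
  assumes inj: "inj_on f X" and C: "\<And>x y. x \<in> X \<Longrightarrow> y \<in> X \<Longrightarrow> C' (f x) (f y) \<longleftrightarrow> C x y"
  shows "top_of_set (flag_realization C X) homeomorphic_space top_of_set (flag_realization C' (f ` X))"
proof -
  let ?F = "\<lambda>t y. if y \<in> f ` X then t (inv_into X f y) else (0::real)"
  let ?G = "\<lambda>s x. if x \<in> X then s (f x) else (0::real)"
  have "homeomorphic_maps (top_of_set (flag_realization C X)) (top_of_set (flag_realization C' (f ` X))) ?F ?G"
    unfolding homeomorphic_maps_def continuous_map_subtopology_eu topspace_subtopology
  proof (intro conjI ballI)
    have "continuous_on T (\<lambda>t. ?F t y)" for T y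
      by (cases "y \<in> f ` X") (simp_all add: continuous_on_coordinate)
    then show "continuous_on (flag_realization C X) ?F"
      by (rule continuous_on_coordinatewise_then_product)
    have "continuous_on T (\<lambda>t. ?G t x)" for T x
      by (cases "x \<in> X") (simp_all add: continuous_on_coordinate)
    then show "continuous_on (flag_realization C' (f ` X)) ?G"
      by (rule continuous_on_coordinatewise_then_product)
    show "?F \<in> flag_realization C X \<rightarrow> flag_realization C' (f ` X)"
    proof
      fix t assume t: "t \<in> flag_realization C X"
      have "sum (?F t) (f ` X) = sum t X"
        using inj by (simp add: sum.reindex)
      then show "?F t \<in> flag_realization C' (f ` X)"
        using t inj C unfolding flag_realization_def by (auto split: if_splits)
    qed
    show "?G \<in> flag_realization C' (f ` X) \<rightarrow> flag_realization C X"
    proof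
      fix t assume t: "t \<in> flag_realization C' (f ` X)"
      have "sum (?G t) X = sum t (f ` X)"
        using inj by (simp add: sum.reindex)
      then show "?G t \<in> flag_realization C X"
        using t C[THEN iffD1] unfolding flag_realization_def by (auto split: if_splits)
    qed
    show "?G (?F t) = t" if "t \<in> topspace euclidean \<inter> flag_realization C X" for t
      using that inj flag_realizationD(2)[of t C X] by (auto simp: fun_eq_iff)
    show "?F (?G t) = t" if "t \<in> topspace euclidean \<inter> flag_realization C' (f ` X)" for t
      using that flag_realizationD(2)[of t C' "f ` X"] by (auto simp: fun_eq_iff f_inv_into_f inv_into_into)
  qed
  then show ?thesis unfolding homeomorphic_space_def by blast
qed

text \<open>Stated for comparability instead of the order, so that it covers the order-reversing
  bijection \<open>reverse_labels\<close> as well as the embeddings \<open>Inl\<close> and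
  \<open>Inr\<close>.\<close>

lemma contractible_poset_image:
  assumes inj: "inj_on f X"
    and C: "\<And>x y. x \<in> X \<Longrightarrow> y \<in> X \<Longrightarrow> comparable R' (f x) (f y) \<longleftrightarrow> comparable R x y"
  shows "contractible_poset R' (f ` X) \<longleftrightarrow> contractible_poset R X"
  using homeomorphic_space_contractibility[OF homeomorphic_flag_realization[of f X "comparable R'" "comparable R", OF assms]]
  by (simp add: contractible_poset_def finite_image_iff[OF inj])

text \<open>The mapping cylinder of \<open>f\<close>, with the codomain placed below the domain. The
  sum type keeps the two posets disjoint.\<close>

fun cylinder_le :: "('a \<Rightarrow> 'a \<Rightarrow> bool) \<Rightarrow> ('b \<Rightarrow> 'b \<Rightarrow> bool) \<Rightarrow> ('a \<Rightarrow> 'b) \<Rightarrow> 'a + 'b \<Rightarrow> 'a + 'b \<Rightarrow> bool" where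
  "cylinder_le R R' f (Inl p) (Inl p') = R p p'"
| "cylinder_le R R' f (Inr q) (Inr q') = R' q q'"
| "cylinder_le R R' f (Inr q) (Inl p) = R' q (f p)"
| "cylinder_le R R' f (Inl p) (Inr q) = False"

text \<open>The cylinder is compared with both of its ends. Above a removed point \<open>q\<close>
  of \<open>Q\<close> lies its fibre in \<open>P\<close>; below a removed point \<open>p\<close> of
  \<open>P\<close> lie the elements of \<open>Q\<close> below \<open>f p\<close>, which have the top
  \<open>f p\<close>. All these are contractible.\<close>

theorem Quillen_fibre_lemma:
  assumes P: "poset_on P R" "finite P" and Q: "poset_on Q R'" "finite Q"
    and f: "f ` P \<subseteq> Q" and mono: "\<And>p p'. p \<in> P \<Longrightarrow> p' \<in> P \<Longrightarrow> R p p' \<Longrightarrow> R' (f p) (f p')"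
    and fib: "\<And>q. q \<in> Q \<Longrightarrow> contractible_poset R {p \<in> P. R' q (f p)}"
  shows "contractible_poset R P \<longleftrightarrow> contractible_poset R' Q"
proof -
  let ?R = "cylinder_le R R' f" and ?B = "Inl ` P \<union> Inr ` Q"
  have fQ: "f p \<in> Q" if "p \<in> P" for p using f that by blast
  have po: "poset_on ?B ?R"
    unfolding poset_on_def
  proof (intro conjI reflp_onI antisymp_onI transp_onI)
    show "?R x x" if "x \<in> ?B" for x
      using that poset_onD(1)[OF P(1)] poset_onD(1)[OF Q(1)] by auto
    show "x = y" if "x \<in> ?B" "y \<in> ?B" "?R x y" "?R y x" for x y
      using that poset_onD(2)[OF P(1)] poset_onD(2)[OF Q(1)] by auto
    show "?R x z" if tr: "x \<in> ?B" "y \<in> ?B" "z \<in> ?B" "?R x y" "?R y z" for x y z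
    proof (cases z)
      case z: (Inl p'')
      show ?thesis
      proof (cases y)
        case y: (Inl p')
        show ?thesis
        proof (cases x)
          case x: (Inl p)
          show ?thesis using tr x y z poset_onD(3)[OF P(1), of p p' p''] by auto
        next
          case x: (Inr q)
          have "p' \<in> P" "p'' \<in> P" "R p' p''" using tr y z by auto
          then show ?thesis
            using tr x y z poset_onD(3)[OF Q(1), of q "f p'" "f p''"] mono[of p' p''] fQ by auto
        qed
      next
        case y: (Inr q')
        then obtain q where x: "x = Inr q" using tr by (cases x) auto
        show ?thesis using tr x y z poset_onD(3)[OF Q(1), of q q' "f p''"] fQ by auto
      qed
    next
      case z: (Inr q'')
      then obtain q' where y: "y = Inr q'" using tr by (cases y) auto
      then obtain q where x: "x = Inr q" using tr by (cases x) auto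
      show ?thesis using tr x y z poset_onD(3)[OF Q(1), of q q' q''] by auto
    qed
  qed
  have fin: "finite ?B" using P Q by simp
  have "contractible_poset ?R (Inl ` X) \<longleftrightarrow> contractible_poset R X" for X
    by (rule contractible_poset_image) (auto simp: comparable_def)
  moreover have "contractible_poset ?R (Inr ` Y) \<longleftrightarrow> contractible_poset R' Y" for Y
    by (rule contractible_poset_image) (auto simp: comparable_def)
  moreover have "contractible_poset ?R ?B \<longleftrightarrow> contractible_poset ?R (Inl ` P)"
  proof (rule contractible_poset_upper_fibres[OF po fin])
    fix b assume "b \<in> ?B" "b \<notin> Inl ` P"
    then obtain q where q: "q \<in> Q" "b = Inr q" by auto
    then have "{a \<in> Inl ` P. ?R b a} = Inl ` {p \<in> P. R' q (f p)}" by auto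
    then show "contractible_poset ?R {a \<in> Inl ` P. ?R b a}"
      using fib[OF q(1)] calculation(1) by simp
  qed auto
  moreover have "contractible_poset ?R ?B \<longleftrightarrow> contractible_poset ?R (Inr ` Q)"
  proof (rule contractible_poset_lower_fibres[OF po fin])
    fix b assume "b \<in> ?B" "b \<notin> Inr ` Q"
    then obtain p where p: "p \<in> P" "b = Inl p" by auto
    then have eq: "{a \<in> Inr ` Q. ?R a b} = Inr ` {q \<in> Q. R' q (f p)}" by auto
    have "contractible_poset R' {q \<in> Q. R' q (f p)}"
    proof (rule contractible_poset_top)
      show "poset_on {q \<in> Q. R' q (f p)} R'" by (rule poset_on_subset[OF Q(1)]) simp
      show "f p \<in> {q \<in> Q. R' q (f p)}" using fQ[OF p(1)] poset_onD(1)[OF Q(1)] by simp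
    qed (use Q(2) in auto)
    then show "contractible_poset ?R {a \<in> Inr ` Q. ?R a b}"
      using calculation(2) eq by simp
  qed auto
  ultimately show ?thesis by blast
qed

section \<open>Box products and restrictions of labelled graphs\<close>

lemma edges_mono: "T \<subseteq> S \<Longrightarrow> edges T \<subseteq> edges S"
  by (auto simp: edges_def)

lemma pair_in_edges: "{x, y} \<in> edges S \<longleftrightarrow> x \<in> S \<and> y \<in> S \<and> x \<noteq> y"
  by (auto simp: edges_def doubleton_eq_iff)

lemma edgesE:
  assumes "e \<in> edges S"
  obtains x y where "x \<in> S" "y \<in> S" "x \<noteq> y" "e = {x, y}"
  using assms by (auto simp: edges_def)

lemma edges_Un:
  assumes "e \<in> edges (S1 \<union> S2)"
  obtains "e \<in> edges S1" | "e \<in> edges S2" | x y where "x \<in> S1" "y \<in> S2" "e = {x, y}"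
  using assms
proof (rule edgesE)
  fix x y assume xy: "x \<in> S1 \<union> S2" "y \<in> S1 \<union> S2" "x \<noteq> y" "e = {x, y}"
  have "e = {y, x}" using xy by auto
  then show thesis using that xy by (auto simp: pair_in_edges)
qed

lemma edges_small: "finite S \<Longrightarrow> card S \<le> 1 \<Longrightarrow> edges S = {}"
  by (auto simp: edges_def card_le_Suc0_iff_eq)

lemma finite_edges: "finite S \<Longrightarrow> finite (edges S)"
  by (rule finite_subset[of _ "Pow S"]) (auto simp: edges_def)

lemma graph_box_left: "e \<in> edges S1 \<Longrightarrow> graph_box S1 S2 i \<mu>1 \<mu>2 e = \<mu>1 e"
  using edges_mono[of S1 "S1 \<union> S2"] by (auto simp: graph_box_def)

lemma graph_box_right: "S1 \<inter> S2 = {} \<Longrightarrow> e \<in> edges S2 \<Longrightarrow> graph_box S1 S2 i \<mu>1 \<mu>2 e = \<mu>2 e"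
  using edges_mono[of S2 "S1 \<union> S2"]
  by (auto simp: graph_box_def edges_def doubleton_eq_iff)

lemma G_objsD:
  assumes "\<mu> \<in> G_objs n S" "x \<in> S" "y \<in> S" "x \<noteq> y"
  shows "lab \<mu> {x, y} \<in> {1..n}" "ori \<mu> {x, y} = (x, y) \<or> ori \<mu> {x, y} = (y, x)"
  using assms by (auto simp: G_objs_def)

lemma finite_G_objs:
  assumes "finite S"
  shows "finite (G_objs n S)"
proof (rule finite_subset)
  show "G_objs n S \<subseteq> PiE (edges S) (\<lambda>_. {1..n} \<times> S \<times> S)"
  proof (intro subsetI PiE_I)
    fix \<mu> e assume \<mu>: "\<mu> \<in> G_objs n S" and "e \<in> edges S"
    then obtain x y where "x \<in> S" "y \<in> S" "x \<noteq> y" "e = {x, y}" by (metis edgesE)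
    then show "\<mu> e \<in> {1..n} \<times> S \<times> S"
      using G_objsD[OF \<mu>, of x y] by (cases "\<mu> e") (auto simp: lab_def ori_def)
  qed (auto simp: G_objs_def extensional_def)
  show "finite (PiE (edges S) (\<lambda>_. {1..n} \<times> S \<times> S))"
    using assms by (intro finite_PiE finite_edges) auto
qed

lemma G_le_refl: "G_le S \<mu> \<mu>"
  by (simp add: G_le_def)

lemma G_le_trans: "G_le S \<mu> \<nu> \<Longrightarrow> G_le S \<nu> \<rho> \<Longrightarrow> G_le S \<mu> \<rho>"
  unfolding G_le_def by fastforce

lemma G_le_subset: "G_le S \<mu> \<nu> \<Longrightarrow> T \<subseteq> S \<Longrightarrow> G_le T \<mu> \<nu>"
  using edges_mono[of T S] unfolding G_le_def by blast

lemma G_le_cong: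
  assumes "\<And>e. e \<in> edges S \<Longrightarrow> \<mu> e = \<mu>' e" "\<And>e. e \<in> edges S \<Longrightarrow> \<nu> e = \<nu>' e"
  shows "G_le S \<mu> \<nu> \<longleftrightarrow> G_le S \<mu>' \<nu>'"
  unfolding G_le_def lab_def ori_def using assms by simp

lemma poset_on_G_objs: "poset_on (G_objs n S) (G_le S)"
  unfolding poset_on_def
proof (intro conjI reflp_onI antisymp_onI transp_onI)
  show "\<mu> = \<nu>" if \<mu>: "\<mu> \<in> G_objs n S" and \<nu>: "\<nu> \<in> G_objs n S" and le: "G_le S \<mu> \<nu>" "G_le S \<nu> \<mu>" for \<mu> \<nu>
  proof
    fix e
    show "\<mu> e = \<nu> e"
    proof (cases "e \<in> edges S")
      case True
      then have "lab \<mu> e = lab \<nu> e" "ori \<mu> e = ori \<nu> e" using le by (force simp: G_le_def)+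
      then show ?thesis by (simp add: lab_def ori_def prod_eq_iff)
    next
      case False
      then show ?thesis using \<mu> \<nu> by (simp add: G_objs_def extensional_def)
    qed
  qed
qed (auto intro: G_le_refl G_le_trans)

section \<open>Vertices without incoming edges of a given label\<close>

definition sources :: "nat \<Rightarrow> 'a set \<Rightarrow> 'a graph_obj \<Rightarrow> 'a set" where
  "sources l S \<mu> = {x \<in> S. \<forall>y\<in>S. y \<noteq> x \<longrightarrow> \<mu> {x, y} \<noteq> (l, y, x)}"

text \<open>Omits the extensionality required in \<open>G_objs\<close>, so that one object
  \<open>b\<close> can be used over all subsets of \<open>S\<close> without being
  restricted.\<close>

definition labelled_ge :: "nat \<Rightarrow> nat \<Rightarrow> 'a set \<Rightarrow> 'a graph_obj \<Rightarrow> bool" where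
  "labelled_ge n m S \<mu> \<longleftrightarrow>
     (\<forall>x\<in>S. \<forall>y\<in>S. x \<noteq> y \<longrightarrow> lab \<mu> {x, y} \<in> {m..n} \<and> ori \<mu> {x, y} \<in> {(x, y), (y, x)})"

text \<open>A finite directed graph has no oriented cycle iff each nonempty set of vertices contains
  one without a predecessor in the set. In this form acyclicity passes to subsets and directly
  yields nonempty sets of sources.\<close>

definition level_acyclic :: "'a set \<Rightarrow> 'a graph_obj \<Rightarrow> bool" where
  "level_acyclic S \<mu> \<longleftrightarrow> (\<forall>l T. T \<subseteq> S \<longrightarrow> T \<noteq> {} \<longrightarrow> sources l T \<mu> \<noteq> {})"

definition M_low :: "nat \<Rightarrow> nat \<Rightarrow> 'a set \<Rightarrow> 'a graph_obj set" where
  "M_low n m S = {\<mu>. M_down n S \<mu> \<and> (\<forall>e\<in>edges S. m \<le> lab \<mu> e)}"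

lemma graph_box_in_G_objs:
  assumes "S1 \<inter> S2 = {}" "\<mu>1 \<in> G_objs n S1" "\<mu>2 \<in> G_objs n S2" "1 \<le> i" "i \<le> n"
  shows "graph_box S1 S2 i \<mu>1 \<mu>2 \<in> G_objs n (S1 \<union> S2)"
proof -
  let ?\<mu> = "graph_box S1 S2 i \<mu>1 \<mu>2"
  have "lab ?\<mu> {x, y} \<in> {1..n} \<and> ori ?\<mu> {x, y} \<in> {(x, y), (y, x)}"
    if xy: "x \<in> S1 \<union> S2" "y \<in> S1 \<union> S2" "x \<noteq> y" for x y
  proof -
    consider "x \<in> S1" "y \<in> S1" | "x \<in> S2" "y \<in> S2" | "x \<in> S1" "y \<in> S2" | "x \<in> S2" "y \<in> S1"
      using xy by blast
    then show ?thesis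
    proof cases
      case 1
      then show ?thesis using G_objsD[OF assms(2), of x y] graph_box_left[of "{x, y}" S1 S2 i \<mu>1 \<mu>2] xy(3)
        by (auto simp: pair_in_edges lab_def ori_def)
    next
      case 2
      then show ?thesis using G_objsD[OF assms(3), of x y] graph_box_right[OF assms(1), of "{x, y}" i \<mu>1 \<mu>2] xy(3)
        by (auto simp: pair_in_edges lab_def ori_def)
    next
      case 3
      then show ?thesis using graph_box_cross[OF assms(1), of x y i \<mu>1 \<mu>2] assms(4,5)
        by (auto simp: lab_def ori_def)
    next
      case 4
      then show ?thesis using graph_box_cross[OF assms(1), of y x i \<mu>1 \<mu>2] assms(4,5)
        by (auto simp: lab_def ori_def insert_commute)
    qed
  qed
  then show ?thesis unfolding G_objs_def by (auto simp: graph_box_def)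
qed

lemma undefined_in_G_objs: "finite S \<Longrightarrow> card S \<le> 1 \<Longrightarrow> (\<lambda>_. undefined) \<in> G_objs n S"
  by (auto simp: G_objs_def card_le_Suc0_iff_eq extensional_def)

lemma M_down_G_objs: "M_down n S \<mu> \<Longrightarrow> \<mu> \<in> G_objs n S"
proof (induction rule: M_down.induct)
  case (M_down_box S S1 S2 i \<mu>1 \<mu>2)
  then show ?case
    using graph_box_in_G_objs[of S1 S2 \<mu>1 n \<mu>2 i] by (auto simp: ordered_partition_def)
qed (rule undefined_in_G_objs)

text \<open>If \<open>T\<close> meets both blocks, the restriction is the box of the two
  restrictions with the same label \<open>i\<close>; otherwise it is a restriction of a single
  factor, and the box disappears.\<close>

lemma M_down_restrict: "M_down n S \<mu> \<Longrightarrow> T \<subseteq> S \<Longrightarrow> M_down n T (restrict \<mu> (edges T))"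
proof (induction arbitrary: T rule: M_down.induct)
  case (M_down_small S)
  then have "finite T" "card T \<le> 1"
    using finite_subset card_mono order_trans by metis+
  then show ?case
    using M_down.M_down_small[of T n] by (simp add: edges_small restrict_def)
next
  case (M_down_box S S1 S2 i \<mu>1 \<mu>2)
  let ?\<mu> = "graph_box S1 S2 i \<mu>1 \<mu>2"
  let ?T1 = "T \<inter> S1" and ?T2 = "T \<inter> S2"
  have dis: "S1 \<inter> S2 = {}" and un: "S1 \<union> S2 = S"
    using M_down_box.hyps(2) by (auto simp: ordered_partition_def)
  have T: "T = ?T1 \<union> ?T2" "?T1 \<inter> ?T2 = {}" using M_down_box.prems un dis by auto
  have L: "?\<mu> e = \<mu>1 e" if "e \<in> edges ?T1" for e
    using graph_box_left edges_mono[of ?T1 S1] that by (metis inf_le2 subsetD)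
  have R: "?\<mu> e = \<mu>2 e" if "e \<in> edges ?T2" for e
    using graph_box_right[OF dis] edges_mono[of ?T2 S2] that by (metis inf_le2 subsetD)
  consider "?T1 = {}" | "?T2 = {}" | "?T1 \<noteq> {}" "?T2 \<noteq> {}" by blast
  then show ?case
  proof cases
    case 1
    then have "T = ?T2" using T by simp
    then have "restrict ?\<mu> (edges T) = restrict \<mu>2 (edges T)"
      using R by (auto simp: restrict_def fun_eq_iff)
    then show ?thesis using M_down_box.IH(2)[of T] \<open>T = ?T2\<close> by auto
  next
    case 2
    then have "T = ?T1" using T by simp
    then have "restrict ?\<mu> (edges T) = restrict \<mu>1 (edges T)"
      using L by (auto simp: restrict_def fun_eq_iff)
    then show ?thesis using M_down_box.IH(1)[of T] \<open>T = ?T1\<close> by auto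
  next
    case 3
    let ?\<mu>1 = "restrict \<mu>1 (edges ?T1)" and ?\<mu>2 = "restrict \<mu>2 (edges ?T2)"
    have "M_down n T (graph_box ?T1 ?T2 i ?\<mu>1 ?\<mu>2)"
    proof (rule M_down.M_down_box)
      show "finite T" using M_down_box finite_subset by blast
      show "ordered_partition T ?T1 ?T2" using T 3 by (auto simp: ordered_partition_def)
      show "M_down n ?T1 ?\<mu>1" "M_down n ?T2 ?\<mu>2"
        by (rule M_down_box.IH; simp)+
      show "\<forall>e\<in>edges ?T1. lab ?\<mu>1 e \<in> {i..n}" "\<forall>e\<in>edges ?T2. lab ?\<mu>2 e \<in> {i..n}"
        using M_down_box.hyps edges_mono[of ?T1 S1] edges_mono[of ?T2 S2] by (auto simp: lab_def)
    qed (use M_down_box.hyps in auto)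
    moreover have "graph_box ?T1 ?T2 i ?\<mu>1 ?\<mu>2 = restrict ?\<mu> (edges T)"
    proof
      fix e
      show "graph_box ?T1 ?T2 i ?\<mu>1 ?\<mu>2 e = restrict ?\<mu> (edges T) e"
      proof (cases "e \<in> edges T")
        case True
        then have "e \<in> edges (?T1 \<union> ?T2)" using T(1) by simp
        then show ?thesis
        proof (cases rule: edges_Un)
          case 1
          then show ?thesis using L True by (simp add: graph_box_left)
        next
          case 2
          then show ?thesis using R True T(2) by (simp add: graph_box_right)
        next
          case (3 x y)
          then show ?thesis
            using True graph_box_cross[OF T(2), of x y i] graph_box_cross[OF dis, of x y i] by simp
        qed
      next
        case False
        then have "e \<notin> edges (?T1 \<union> ?T2)" using T(1) by simp
        then show ?thesis using False by (simp add: graph_box_def)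
      qed
    qed
    ultimately show ?thesis by (simp only:)
  qed
qed

text \<open>The edges between the blocks leave \<open>S1\<close>, so a source of the first factor
  remains a source of the box, whatever the label \<open>l\<close>.\<close>

lemma sources_M_down: "M_down n S \<mu> \<Longrightarrow> S \<noteq> {} \<Longrightarrow> sources l S \<mu> \<noteq> {}"
proof (induction rule: M_down.induct)
  case (M_down_small S)
  then have "card S = 1" by (simp add: le_Suc_eq)
  then obtain x where "S = {x}" by (rule card_1_singletonE)
  then show ?case by (auto simp: sources_def)
next
  case (M_down_box S S1 S2 i \<mu>1 \<mu>2)
  then have part: "S1 \<noteq> {}" "S1 \<inter> S2 = {}" "S1 \<union> S2 = S" by (auto simp: ordered_partition_def)
  then obtain x where x: "x \<in> sources l S1 \<mu>1" using M_down_box.IH by blast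
  have "graph_box S1 S2 i \<mu>1 \<mu>2 {x, y} \<noteq> (l, y, x)" if "y \<in> S" "y \<noteq> x" for y
  proof (cases "y \<in> S1")
    case True
    then show ?thesis using x that graph_box_left[of "{x, y}" S1] by (auto simp: sources_def pair_in_edges)
  next
    case False
    then show ?thesis using x that part graph_box_cross[of S1 S2 x y] by (auto simp: sources_def)
  qed
  then show ?case using x part by (auto simp: sources_def)
qed

lemma labelled_geD:
  assumes "labelled_ge n m S \<mu>" "x \<in> S" "y \<in> S" "x \<noteq> y"
  shows "m \<le> lab \<mu> {x, y}" "lab \<mu> {x, y} \<le> n" "ori \<mu> {x, y} = (x, y) \<or> ori \<mu> {x, y} = (y, x)"
  using assms by (auto simp: labelled_ge_def)

lemma labelled_ge_edge:
  assumes "labelled_ge n m S \<mu>" "e \<in> edges S"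
  shows "m \<le> lab \<mu> e" "lab \<mu> e \<le> n"
proof -
  obtain x y where "x \<in> S" "y \<in> S" "x \<noteq> y" "e = {x, y}" using assms(2) by (rule edgesE)
  then show "m \<le> lab \<mu> e" "lab \<mu> e \<le> n" using labelled_geD[OF assms(1), of x y] by auto
qed

lemma labelled_ge_subset: "labelled_ge n m S \<mu> \<Longrightarrow> T \<subseteq> S \<Longrightarrow> labelled_ge n m T \<mu>"
  unfolding labelled_ge_def by blast

lemma M_low_labelled: "\<mu> \<in> M_low n m S \<Longrightarrow> labelled_ge n m S \<mu>"
  using G_objsD[OF M_down_G_objs, of n S \<mu>]
  unfolding M_low_def labelled_ge_def by (auto simp: pair_in_edges)

lemma M_low_G_objs: "\<mu> \<in> M_low n m S \<Longrightarrow> \<mu> \<in> G_objs n S"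
  using M_down_G_objs by (auto simp: M_low_def)

text \<open>An edge of \<open>\<nu>\<close> with label \<open>m\<close> into \<open>x\<close> has
  the same label in \<open>\<mu>\<close>, since \<open>m\<close> is the least one allowed; with
  equal labels the order forces equal orientations.\<close>

lemma sources_mono:
  assumes "labelled_ge n m S \<mu>" "G_le S \<mu> \<nu>"
  shows "sources m S \<mu> \<subseteq> sources m S \<nu>"
proof
  fix x assume x: "x \<in> sources m S \<mu>"
  have "\<nu> {x, y} \<noteq> (m, y, x)" if y: "y \<in> S" "y \<noteq> x" for y
  proof
    assume \<nu>: "\<nu> {x, y} = (m, y, x)"
    have "{x, y} \<in> edges S" "m \<le> lab \<mu> {x, y}"
      using x y labelled_geD(1)[OF assms(1), of x y] by (auto simp: pair_in_edges sources_def)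
    then have "lab \<mu> {x, y} = m" "ori \<mu> {x, y} = (y, x)"
      using assms(2) \<nu> by (force simp: G_le_def lab_def ori_def)+
    then have "\<mu> {x, y} = (m, y, x)" by (simp add: lab_def ori_def prod_eq_iff)
    then show False using x y by (auto simp: sources_def)
  qed
  then show "x \<in> sources m S \<nu>" using x by (auto simp: sources_def)
qed

text \<open>An edge of label \<open>m\<close> between two sources would enter one of them.\<close>

lemma labelled_ge_sources:
  assumes "labelled_ge n m S \<mu>" "T \<subseteq> sources m S \<mu>"
  shows "labelled_ge n (Suc m) T \<mu>"
  unfolding labelled_ge_def
proof (intro ballI impI)
  fix x y assume xy: "x \<in> T" "y \<in> T" "x \<noteq> y"
  then have S: "x \<in> S" "y \<in> S" using assms(2) by (auto simp: sources_def)
  have "x \<in> sources m S \<mu>" "y \<in> sources m S \<mu>" using xy assms(2) by blast+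
  then have "\<mu> {x, y} \<noteq> (m, y, x)" "\<mu> {y, x} \<noteq> (m, x, y)"
    using xy(3) S by (simp_all add: sources_def)
  then have "\<mu> {x, y} \<noteq> (m, y, x)" "\<mu> {x, y} \<noteq> (m, x, y)"
    by (simp_all add: insert_commute)
  then have "lab \<mu> {x, y} \<noteq> m"
    using labelled_geD(3)[OF assms(1) S xy(3)] by (auto simp: lab_def ori_def prod_eq_iff)
  then show "lab \<mu> {x, y} \<in> {Suc m..n} \<and> ori \<mu> {x, y} \<in> {(x, y), (y, x)}"
    using labelled_geD[OF assms(1) S xy(3)] by auto
qed

lemma sources_all: "labelled_ge n (Suc m) S \<mu> \<Longrightarrow> sources m S \<mu> = S"
  by (force simp: sources_def labelled_ge_def lab_def)

text \<open>On an edge from \<open>x \<in> T\<close> to \<open>y\<close>, the value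
  \<open>(m, x, y)\<close> could fail to be below that of \<open>\<nu>\<close> only if the latter
  were \<open>(m, y, x)\<close>, which is excluded because \<open>x\<close> is a source of
  \<open>\<nu>\<close>.\<close>

lemma graph_box_G_le:
  assumes \<nu>: "labelled_ge n m S \<nu>" and T: "T \<subseteq> sources m S \<nu>"
    and le: "G_le T \<alpha> \<nu>" "G_le (S - T) \<beta> \<nu>"
  shows "G_le S (graph_box T (S - T) m \<alpha> \<beta>) \<nu>"
  unfolding G_le_def
proof
  let ?\<mu> = "graph_box T (S - T) m \<alpha> \<beta>"
  have TS: "T \<union> (S - T) = S" "T \<inter> (S - T) = {}" using T by (auto simp: sources_def)
  fix e assume "e \<in> edges S"
  then have "e \<in> edges (T \<union> (S - T))" using TS by simp
  then show "ori ?\<mu> e = ori \<nu> e \<and> lab ?\<mu> e \<le> lab \<nu> e \<or> ori ?\<mu> e \<noteq> ori \<nu> e \<and> lab ?\<mu> e < lab \<nu> e"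
  proof (cases rule: edges_Un)
    case 1
    then show ?thesis using le(1) by (auto simp: G_le_def graph_box_left lab_def ori_def)
  next
    case 2
    then show ?thesis using le(2) by (auto simp: G_le_def graph_box_right lab_def ori_def)
  next
    case (3 x y)
    then have xy: "x \<in> S" "y \<in> S" "x \<noteq> y" using TS by auto
    have "x \<in> sources m S \<nu>" using T 3(1) by blast
    then have "\<nu> {x, y} \<noteq> (m, y, x)" using xy by (simp add: sources_def)
    then have "lab \<nu> e \<noteq> m \<or> ori \<nu> e \<noteq> (y, x)"
      using 3(3) by (auto simp: lab_def ori_def prod_eq_iff)
    moreover have "m \<le> lab \<nu> e" "ori \<nu> e = (x, y) \<or> ori \<nu> e = (y, x)"
      using labelled_geD[OF \<nu> xy] 3(3) by simp_all
    moreover have "lab ?\<mu> e = m" "ori ?\<mu> e = (x, y)"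
      using graph_box_cross[OF TS(2) 3(1,2), of m \<alpha> \<beta>] 3(3) by (simp_all add: lab_def ori_def)
    ultimately show ?thesis by auto
  qed
qed

lemma M_low_restrict:
  assumes "\<mu> \<in> M_low n m S" "T \<subseteq> S" "labelled_ge n m' T \<mu>"
  shows "restrict \<mu> (edges T) \<in> M_low n m' T"
proof -
  have "m' \<le> lab (restrict \<mu> (edges T)) e" if e: "e \<in> edges T" for e
    using labelled_ge_edge(1)[OF assms(3) e] e by (simp add: lab_def)
  then show ?thesis using assms(1) M_down_restrict[OF _ assms(2), of n \<mu>] by (auto simp: M_low_def)
qed

lemma level_acyclic_subset: "level_acyclic S b \<Longrightarrow> T \<subseteq> S \<Longrightarrow> level_acyclic T b"
  unfolding level_acyclic_def by (meson order_trans)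

section \<open>Objects of the poset below a given one\<close>

text \<open>The strict bound on \<open>\<alpha>\<close> makes \<open>T\<close> consist of sources:
  no edge inside \<open>T\<close> has label \<open>m\<close>, and all edges across lead out of
  \<open>T\<close>.\<close>

lemma graph_box_in_M_low:
  assumes fin: "finite S" and T: "T \<subseteq> S" "T \<noteq> {}" "T \<noteq> S" and m: "1 \<le> m" "m \<le> n"
    and \<alpha>: "\<alpha> \<in> M_low n (Suc m) T" and \<beta>: "\<beta> \<in> M_low n m (S - T)"
  shows "graph_box T (S - T) m \<alpha> \<beta> \<in> M_low n m S" "T \<subseteq> sources m S (graph_box T (S - T) m \<alpha> \<beta>)"
proof -
  let ?\<mu> = "graph_box T (S - T) m \<alpha> \<beta>"
  have part: "ordered_partition S T (S - T)" using T by (auto simp: ordered_partition_def)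
  have dis: "T \<inter> (S - T) = {}" and un: "T \<union> (S - T) = S" using T by auto
  have lab: "m \<le> lab \<alpha> e" "lab \<alpha> e \<noteq> m" "lab \<alpha> e \<le> n" if e: "e \<in> edges T" for e
    using labelled_ge_edge[OF M_low_labelled[OF \<alpha>] e] by auto
  have lab': "m \<le> lab \<beta> e" "lab \<beta> e \<le> n" if e: "e \<in> edges (S - T)" for e
    using labelled_ge_edge[OF M_low_labelled[OF \<beta>] e] by auto
  have "M_down n S ?\<mu>"
    by (rule M_down.M_down_box[OF fin part m]) (use \<alpha> \<beta> lab lab' in \<open>auto simp: M_low_def\<close>)
  moreover have "m \<le> lab ?\<mu> e" if "e \<in> edges S" for e
  proof -
    have "e \<in> edges (T \<union> (S - T))" using that un by simp
    then show ?thesis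
    proof (cases rule: edges_Un)
      case 1 then show ?thesis using lab(1) by (simp add: lab_def graph_box_left)
    next
      case 2 then show ?thesis using lab'(1) dis by (simp add: lab_def graph_box_right)
    next
      case (3 x y)
      then show ?thesis using graph_box_cross[OF dis 3(1,2), of m \<alpha> \<beta>] by (simp add: lab_def)
    qed
  qed
  ultimately show "?\<mu> \<in> M_low n m S" by (simp add: M_low_def)
  show "T \<subseteq> sources m S ?\<mu>"
  proof
    fix x assume x: "x \<in> T"
    have "?\<mu> {x, y} \<noteq> (m, y, x)" if y: "y \<in> S" "y \<noteq> x" for y
    proof (cases "y \<in> T")
      case True
      then have e: "{x, y} \<in> edges T" using x y by (simp add: pair_in_edges)
      then have "?\<mu> {x, y} = \<alpha> {x, y}" by (rule graph_box_left)
      then show ?thesis using lab(2)[OF e] by (auto simp: lab_def)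
    next
      case False
      then show ?thesis using graph_box_cross[OF dis x, of y m \<alpha> \<beta>] y by simp
    qed
    then show "x \<in> sources m S ?\<mu>" using x T by (auto simp: sources_def)
  qed
qed

lemma finite_M_low: "finite S \<Longrightarrow> finite (M_low n m S)"
  by (rule finite_subset[OF _ finite_G_objs[of S n]]) (auto intro: M_low_G_objs)

lemma poset_on_M_low: "poset_on (M_low n m S) (G_le S)"
  by (rule poset_on_subset[OF poset_on_G_objs[of n S]]) (auto intro: M_low_G_objs)

text \<open>Restriction of the fibre to \<open>T\<close> and to \<open>S - T\<close> has the box product at label \<open>m\<close> as left adjoint,
  so the fibre is equivalent to a product, which is treated one factor at a time.\<close>

lemma contractible_source_fibre:
  fixes b :: "'a graph_obj"
  assumes fin: "finite S" and m: "1 \<le> m" "m \<le> n" and b: "labelled_ge n m S b"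
    and T: "T \<noteq> {}" "T \<noteq> S" "T \<subseteq> sources m S b"
    and X: "contractible_poset (G_le T) {\<alpha> \<in> M_low n (Suc m) T. G_le T \<alpha> b}"
    and Y: "contractible_poset (G_le (S - T)) {\<beta> \<in> M_low n m (S - T). G_le (S - T) \<beta> b}"
  shows "contractible_poset (G_le S) {\<mu> \<in> M_low n m S. G_le S \<mu> b \<and> T \<subseteq> sources m S \<mu>}"
proof -
  let ?P = "{\<mu> \<in> M_low n m S. G_le S \<mu> b \<and> T \<subseteq> sources m S \<mu>}"
  let ?X = "{\<alpha> \<in> M_low n (Suc m) T. G_le T \<alpha> b}"
  let ?Y = "{\<beta> \<in> M_low n m (S - T). G_le (S - T) \<beta> b}"
  let ?r = "\<lambda>U \<mu>. restrict \<mu> (edges U)"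
  have TS: "T \<subseteq> S" using T(3) by (auto simp: sources_def)
  have finT: "finite T" "finite (S - T)" using fin TS finite_subset by auto
  have r: "G_le U \<alpha> (?r U \<mu>) \<longleftrightarrow> G_le U \<alpha> \<mu>" "G_le U (?r U \<mu>) \<nu> \<longleftrightarrow> G_le U \<mu> \<nu>" for U :: "'a set" and \<alpha> \<mu> \<nu>
    by (rule G_le_cong; simp)+
  have P: "poset_on P' (G_le S)" "finite P'" if "P' \<subseteq> ?P" for P'
    using that poset_on_subset[OF poset_on_M_low[of n m S], of P'] finite_subset[OF _ finite_M_low[OF fin, of n m], of P'] by auto
  have pX: "poset_on ?X (G_le T)" "finite ?X"
    using poset_on_subset[OF poset_on_M_low[of n "Suc m" T], of ?X] finite_M_low[OF finT(1), of n "Suc m"] by auto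
  have pY: "poset_on ?Y (G_le (S - T))" "finite ?Y"
    using poset_on_subset[OF poset_on_M_low[of n m "S - T"], of ?Y] finite_M_low[OF finT(2), of n m] by auto
  have rX: "?r T \<mu> \<in> ?X" if \<mu>: "\<mu> \<in> ?P" for \<mu>
  proof -
    have "labelled_ge n (Suc m) T \<mu>"
      using labelled_ge_sources[OF M_low_labelled, of \<mu> n m S T] \<mu> by simp
    then show ?thesis using M_low_restrict[of \<mu> n m S T "Suc m"] \<mu> TS G_le_subset[of S \<mu> b T] r by simp
  qed
  have rY: "?r (S - T) \<mu> \<in> ?Y" if \<mu>: "\<mu> \<in> ?P" for \<mu>
  proof -
    have "labelled_ge n m (S - T) \<mu>"
      using labelled_ge_subset[OF M_low_labelled, of \<mu> n m S "S - T"] \<mu> by simp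
    then show ?thesis using M_low_restrict[of \<mu> n m S "S - T" m] \<mu> G_le_subset[of S \<mu> b "S - T"] r by simp
  qed
  \<comment> \<open>The fibre lemma is applied twice, one inside the other: the fibre of restriction
    to \<open>T\<close> over \<open>\<alpha>\<close> is mapped to \<open>?Y\<close> by restriction
    to \<open>S - T\<close>, and the fibres of that second map have the box of
    \<open>\<alpha>\<close> and \<open>\<beta>\<close> as least element.\<close>
  have "contractible_poset (G_le S) {\<mu> \<in> ?P. G_le T \<alpha> (?r T \<mu>)}" if \<alpha>: "\<alpha> \<in> ?X" for \<alpha>
  proof -
    let ?P\<alpha> = "{\<mu> \<in> ?P. G_le T \<alpha> (?r T \<mu>)}"
    have "contractible_poset (G_le S) {\<mu> \<in> ?P\<alpha>. G_le (S - T) \<beta> (?r (S - T) \<mu>)}" if \<beta>: "\<beta> \<in> ?Y" for \<beta>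
    proof -
      let ?\<mu> = "graph_box T (S - T) m \<alpha> \<beta>"
      have box: "?\<mu> \<in> M_low n m S" "T \<subseteq> sources m S ?\<mu>"
        using graph_box_in_M_low[OF fin TS T(1,2) m, of \<alpha> \<beta>] \<alpha> \<beta> by auto
      have "G_le S ?\<mu> b"
        by (rule graph_box_G_le[OF b T(3)]) (use \<alpha> \<beta> in auto)
      moreover have "G_le T \<alpha> ?\<mu>"
        by (subst G_le_cong[of T \<alpha> \<alpha> ?\<mu> \<alpha>]) (simp_all add: graph_box_left G_le_refl)
      moreover have "G_le (S - T) \<beta> ?\<mu>"
        by (subst G_le_cong[of "S - T" \<beta> \<beta> ?\<mu> \<beta>]) (simp_all add: graph_box_right G_le_refl)
      ultimately have "?\<mu> \<in> {\<mu> \<in> ?P\<alpha>. G_le (S - T) \<beta> (?r (S - T) \<mu>)}"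
        using box r by simp
      \<comment> \<open>Each \<open>\<mu>\<close> in the fibre has \<open>T\<close> among its
        sources, so it can take the place of \<open>b\<close> in the comparison with the
        box.\<close>
      moreover have "G_le S ?\<mu> \<mu>" if "\<mu> \<in> {\<mu> \<in> ?P\<alpha>. G_le (S - T) \<beta> (?r (S - T) \<mu>)}" for \<mu>
        by (rule graph_box_G_le[of n m S \<mu>]) (use that r M_low_labelled[of \<mu> n m S] in simp_all)
      ultimately show ?thesis
        by (intro contractible_poset_bot[of _ _ ?\<mu>] P) auto
    qed
    then have "contractible_poset (G_le S) ?P\<alpha> \<longleftrightarrow> contractible_poset (G_le (S - T)) ?Y"
      by (intro Quillen_fibre_lemma[where f = "?r (S - T)"] P pY)
        (use rY G_le_subset[of S _ _ "S - T"] r in auto)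
    then show ?thesis using Y by simp
  qed
  then have "contractible_poset (G_le S) ?P \<longleftrightarrow> contractible_poset (G_le T) ?X"
    by (intro Quillen_fibre_lemma[where f = "?r T"] P pX)
      (use rX G_le_subset[of S _ _ T] TS r in auto)
  then show ?thesis using X by simp
qed

lemma contractible_M_low:
  assumes "finite S" "labelled_ge n m S b" "level_acyclic S b" "1 \<le> m"
  shows "contractible_poset (G_le S) {\<mu> \<in> M_low n m S. G_le S \<mu> b}"
  using assms
\<comment> \<open>The measure encodes the lexicographic order on \<open>card S\<close> and
  \<open>n + 1 - m\<close>: the second summand is less than \<open>n + 2\<close>, so a smaller set
  of vertices decreases the sum for every bound on the labels.\<close>
proof (induction "card S * (n + 2) + (n + 1 - m)" arbitrary: S m rule: less_induct)
  case less
  let ?P = "{\<mu> \<in> M_low n m S. G_le S \<mu> b}"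
  show ?case
  proof (cases "card S \<le> 1")
    case True
    have "\<mu> = (\<lambda>_. undefined)" if "\<mu> \<in> M_low n m S" for \<mu>
      using M_low_G_objs[OF that] edges_small[OF less.prems(1) True] by (auto simp: G_objs_def)
    moreover have "(\<lambda>_. undefined) \<in> ?P"
      using M_down.M_down_small[OF less.prems(1) True, of n] edges_small[OF less.prems(1) True]
      by (simp add: M_low_def G_le_def)
    ultimately have "?P = {\<lambda>_. undefined}" by auto
    then show ?thesis by (simp add: contractible_poset_singleton G_le_refl)
  next
    case False
    then obtain x y where xy: "x \<in> S" "y \<in> S" "x \<noteq> y"
      using less.prems(1) by (auto simp: card_le_Suc0_iff_eq)
    \<comment> \<open>\<open>S\<close> has an edge, whose label lies between \<open>m\<close> and
      \<open>n\<close>. So \<open>m\<close> may serve as the label of a box, and passing to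
      \<open>m + 1\<close> decreases the measure.\<close>
    then have mn: "m \<le> n" using labelled_geD[OF less.prems(2), of x y] by linarith
    \<comment> \<open>The empty set is left out because both blocks of an ordered partition are
      nonempty; the map to \<open>?Q\<close> still exists, as every object of \<open>M_down\<close>
      has a source.\<close>
    let ?Q = "{T. T \<subseteq> sources m S b \<and> T \<noteq> {}}"
    have ne: "S \<noteq> {}" using xy by auto
    have top: "sources m S b \<in> ?Q"
      using less.prems(3) ne by (auto simp: level_acyclic_def)
    have "finite (sources m S b)" using less.prems(1) by (simp add: sources_def)
    then have Q: "poset_on ?Q (\<subseteq>)" "finite ?Q"
      by (auto simp: poset_on_def reflp_on_def antisymp_on_def transp_on_def)
    have "contractible_poset (\<subseteq>) ?Q"
      by (rule contractible_poset_top[OF Q top]) auto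
    moreover have "contractible_poset (G_le S) ?P \<longleftrightarrow> contractible_poset (\<subseteq>) ?Q"
    proof (rule Quillen_fibre_lemma[where f = "sources m S"])
      show "poset_on ?P (G_le S)" "finite ?P"
        using poset_on_subset[OF poset_on_M_low[of n m S], of ?P] finite_M_low[OF less.prems(1), of n m] by auto
      show "poset_on ?Q (\<subseteq>)" "finite ?Q" by (fact Q)+
      show "sources m S ` ?P \<subseteq> ?Q"
      proof (intro image_subsetI CollectI conjI)
        fix \<mu> assume \<mu>: "\<mu> \<in> ?P"
        then show "sources m S \<mu> \<subseteq> sources m S b"
          using sources_mono[OF M_low_labelled] by blast
        show "sources m S \<mu> \<noteq> {}"
          using \<mu> sources_M_down[OF _ ne] by (auto simp: M_low_def)
      qed
      show "sources m S \<mu> \<subseteq> sources m S \<nu>" if "\<mu> \<in> ?P" "\<nu> \<in> ?P" "G_le S \<mu> \<nu>" for \<mu> \<nu>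
        using that sources_mono[OF M_low_labelled] by blast
      show "contractible_poset (G_le S) {\<mu> \<in> ?P. T \<subseteq> sources m S \<mu>}" if T: "T \<in> ?Q" for T
      proof (cases "T = S")
        case True
        \<comment> \<open>Here every vertex is a source of \<open>b\<close>, so \<open>b\<close> has
          no edge of label \<open>m\<close>. No box can be formed, but the bound can be
          raised.\<close>
        have bS: "labelled_ge n (Suc m) S b"
          using labelled_ge_sources[OF less.prems(2), of T] T True by simp
        have "\<mu> \<in> M_low n m S \<and> S \<subseteq> sources m S \<mu> \<longleftrightarrow> \<mu> \<in> M_low n (Suc m) S" for \<mu>
        proof
          assume \<mu>: "\<mu> \<in> M_low n m S \<and> S \<subseteq> sources m S \<mu>"
          then have lg: "labelled_ge n (Suc m) S \<mu>"
            using labelled_ge_sources[OF M_low_labelled, of \<mu> n m S S] by simp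
          have "restrict \<mu> (edges S) = \<mu>"
            using M_low_G_objs[of \<mu> n m S] \<mu> by (auto simp: G_objs_def extensional_restrict)
          then show "\<mu> \<in> M_low n (Suc m) S"
            using M_low_restrict[of \<mu> n m S S, OF _ order_refl lg] \<mu> by simp
        next
          assume \<mu>: "\<mu> \<in> M_low n (Suc m) S"
          then show "\<mu> \<in> M_low n m S \<and> S \<subseteq> sources m S \<mu>"
            using sources_all[OF M_low_labelled[OF \<mu>]] by (auto simp: M_low_def)
        qed
        then have "{\<mu> \<in> ?P. T \<subseteq> sources m S \<mu>} = {\<mu> \<in> M_low n (Suc m) S. G_le S \<mu> b}"
          using True by auto
        moreover have "contractible_poset (G_le S) {\<mu> \<in> M_low n (Suc m) S. G_le S \<mu> b}"
          by (rule less.hyps) (use less.prems bS mn in auto)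
        ultimately show ?thesis by simp
      next
        case False
        have TS: "T \<subseteq> S" "T \<noteq> {}" "T \<subseteq> sources m S b" using T by (auto simp: sources_def)
        have "T \<subset> S" "S - T \<subset> S" using TS False by auto
        have small: "card U * (n + 2) + (n + 1 - k) < card S * (n + 2) + (n + 1 - m)" if "U \<subset> S" for U k
        proof -
          have "card U < card S" using that less.prems(1) by (simp add: psubset_card_mono)
          then have "(card U + 1) * (n + 2) \<le> card S * (n + 2)" by (intro mult_le_mono1) simp
          then show ?thesis by simp
        qed
        have "contractible_poset (G_le T) {\<alpha> \<in> M_low n (Suc m) T. G_le T \<alpha> b}"
          by (rule less.hyps)
            (use small[of T "Suc m"] TS False less.prems labelled_ge_sources[OF less.prems(2) TS(3)]
              level_acyclic_subset[of S b T] finite_subset[of T S] \<open>T \<subset> S\<close> in \<open>simp_all del: add_2_eq_Suc'\<close>)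
        moreover have "contractible_poset (G_le (S - T)) {\<beta> \<in> M_low n m (S - T). G_le (S - T) \<beta> b}"
          by (rule less.hyps)
            (use small[of "S - T" m] \<open>S - T \<subset> S\<close> less.prems labelled_ge_subset[OF less.prems(2), of "S - T"]
              level_acyclic_subset[of S b "S - T"] in \<open>simp_all del: add_2_eq_Suc'\<close>)
        ultimately have "contractible_poset (G_le S) {\<mu> \<in> M_low n m S. G_le S \<mu> b \<and> T \<subseteq> sources m S \<mu>}"
          using contractible_source_fibre[OF less.prems(1,4) mn less.prems(2) TS(2) False TS(3)] by blast
        then show ?thesis by (simp add: conj_assoc)
      qed
    qed
    ultimately show ?thesis by simp
  qed
qed

lemma labelled_ge_G_objs: "\<mu> \<in> G_objs n S \<Longrightarrow> labelled_ge n 1 S \<mu>"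
  by (auto simp: labelled_ge_def G_objs_def)

lemma M_low_1: "M_low n 1 S = M_down_objs n S"
proof -
  have "1 \<le> lab \<mu> e" if "M_down n S \<mu>" "e \<in> edges S" for \<mu> :: "'a graph_obj" and e
    using labelled_ge_edge[OF labelled_ge_G_objs[OF M_down_G_objs]] that by blast
  then show ?thesis by (auto simp: M_low_def M_down_objs_def)
qed

text \<open>The case of \<open>M_down\<close> implies the one of a larger \<open>A\<close>: below
  any further object \<open>c \<le> b\<close> of \<open>A\<close>, the objects of
  \<open>M_down\<close> are again of the form already treated, with \<open>c\<close> in place of
  \<open>b\<close>.\<close>

lemma contractible_below:
  assumes fin: "finite S" and A: "A \<subseteq> G_objs n S" "\<And>a. a \<in> A \<Longrightarrow> level_acyclic S a"
    and M: "M_down_objs n S \<subseteq> A" and b: "b \<in> G_objs n S" "level_acyclic S b"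
  shows "contractible_poset (G_le S) {a \<in> A. G_le S a b}"
proof -
  have con: "contractible_poset (G_le S) {\<mu> \<in> M_down_objs n S. G_le S \<mu> c}"
    if "c \<in> G_objs n S" "level_acyclic S c" for c
    using contractible_M_low[OF fin labelled_ge_G_objs[OF that(1)] that(2) order_refl]
    unfolding M_low_1 .
  have "contractible_poset (G_le S) {a \<in> A. G_le S a b} \<longleftrightarrow>
      contractible_poset (G_le S) {\<mu> \<in> M_down_objs n S. G_le S \<mu> b}"
  proof (rule contractible_poset_lower_fibres)
    show "poset_on {a \<in> A. G_le S a b} (G_le S)"
      using A by (intro poset_on_subset[OF poset_on_G_objs[of n S]]) auto
    show "finite {a \<in> A. G_le S a b}"
      using A by (intro finite_subset[OF _ finite_G_objs[OF fin, of n]]) auto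
    fix c assume c: "c \<in> {a \<in> A. G_le S a b}"
    then have "{a \<in> {\<mu> \<in> M_down_objs n S. G_le S \<mu> b}. G_le S a c} = {\<mu> \<in> M_down_objs n S. G_le S \<mu> c}"
      using G_le_trans by blast
    then show "contractible_poset (G_le S) {a \<in> {\<mu> \<in> M_down_objs n S. G_le S \<mu> b}. G_le S a c}"
      using con c A by auto
  qed (use M in auto)
  then show ?thesis using con b by simp
qed

section \<open>Acyclicity and reversal of labels\<close>

text \<open>If each vertex of \<open>T\<close> has a predecessor along an edge of label
  \<open>l\<close>, walking backwards must return to a vertex already visited, which closes a
  monochromatic cycle.\<close>

lemma Ke_level_acyclic:
  assumes fin: "finite S" and \<mu>: "\<mu> \<in> Ke_objs n S"
  shows "level_acyclic S \<mu>"
  unfolding level_acyclic_def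
proof (intro allI impI notI)
  fix l T assume T: "T \<subseteq> S" "T \<noteq> {}" and "sources l T \<mu> = {}"
  then have "\<forall>x\<in>T. \<exists>y\<in>T. y \<noteq> x \<and> \<mu> {x, y} = (l, y, x)"
    by (auto simp: sources_def)
  then obtain p where p: "\<And>x. x \<in> T \<Longrightarrow> p x \<in> T \<and> p x \<noteq> x \<and> \<mu> {x, p x} = (l, p x, x)" by metis
  obtain a where a: "a \<in> T" using T by auto
  have iter: "(p ^^ k) x \<in> T" if "x \<in> T" for k x
    by (induction k) (use p that in auto)
  have "\<not> inj (\<lambda>k. (p ^^ k) a)"
  proof
    assume "inj (\<lambda>k. (p ^^ k) a)"
    then have "infinite (range (\<lambda>k. (p ^^ k) a))" using range_inj_infinite by blast
    moreover have "range (\<lambda>k. (p ^^ k) a) \<subseteq> S" using iter[OF a] T by auto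
    ultimately show False using fin finite_subset by blast
  qed
  then obtain i j where ij: "i < j" "(p ^^ i) a = (p ^^ j) a"
    unfolding inj_def by (metis nat_neq_iff)
  define z where "z = (p ^^ i) a"
  have z: "z \<in> T" using iter[OF a] by (simp add: z_def)
  have "(p ^^ (j - i)) z = (p ^^ (j - i + i)) a"
    unfolding funpow_add z_def by simp
  then have ex: "\<exists>d. 0 < d \<and> (p ^^ d) z = z"
    using ij by (intro exI[of _ "j - i"]) (simp add: z_def)
  \<comment> \<open>The least period makes the \<open>d\<close> iterates distinct; it exceeds 1
    because \<open>p\<close> moves every vertex of \<open>T\<close>.\<close>
  define d where "d = (LEAST d. 0 < d \<and> (p ^^ d) z = z)"
  have d: "0 < d" "(p ^^ d) z = z"
    using LeastI_ex[OF ex] by (simp_all add: d_def)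
  have least: "(p ^^ k) z \<noteq> z" if "0 < k" "k < d" for k
    using not_less_Least[of k "\<lambda>d. 0 < d \<and> (p ^^ d) z = z"] that by (auto simp: d_def)
  have "d \<noteq> 1" using d(2) p[OF z] by auto
  then have d1: "1 < d" using d(1) by simp
  \<comment> \<open>\<open>p\<close> runs against the orientation, so the iterates are listed
    backwards. The closing edge leads from \<open>z\<close>, the last entry, to
    \<open>(p ^^ (d - 1)) z\<close>, the first.\<close>
  let ?xs = "map (\<lambda>i. (p ^^ (d - 1 - i)) z) [0..<d]"
  have inj: "(p ^^ k) z \<noteq> (p ^^ k') z" if "k < k'" "k' < d" for k k'
  proof
    assume "(p ^^ k) z = (p ^^ k') z"
    then have "(p ^^ (d - k')) ((p ^^ k) z) = (p ^^ (d - k')) ((p ^^ k') z)" by simp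
    then have "(p ^^ (d - k' + k)) z = (p ^^ (d - k' + k')) z" by (simp only: funpow_add o_apply)
    moreover have "d - k' + k' = d" "0 < d - k' + k" "d - k' + k < d" using that by auto
    ultimately show False using least[of "d - k' + k"] d(2) by (simp only:)
  qed
  have dist: "distinct ?xs"
    unfolding distinct_map
  proof (intro conjI inj_onI)
    fix s t assume "s \<in> set [0..<d]" "t \<in> set [0..<d]"
      and eq: "(p ^^ (d - 1 - s)) z = (p ^^ (d - 1 - t)) z"
    then have st: "s < d" "t < d" by auto
    then have "d - 1 - s < d" "d - 1 - t < d" by auto
    then have "\<not> d - 1 - s < d - 1 - t" "\<not> d - 1 - t < d - 1 - s"
      using inj[of "d - 1 - s" "d - 1 - t"] inj[of "d - 1 - t" "d - 1 - s"] eq by auto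
    then show "s = t" using st by linarith
  qed simp
  have step: "\<mu> {?xs ! s, ?xs ! (Suc s mod length ?xs)} = (l, ?xs ! s, ?xs ! (Suc s mod length ?xs))"
    if s: "s < length ?xs" for s
  proof -
    define w where "w = ?xs ! (Suc s mod length ?xs)"
    have "w \<in> T \<and> ?xs ! s = p w"
    proof (cases "Suc s = d")
      case True
      have "w = (p ^^ (d - 1)) z" using True d(1) by (simp add: w_def)
      moreover have "?xs ! s = z" using s True by auto
      moreover have "p ((p ^^ (d - 1)) z) = (p ^^ d) z" using d(1) by (cases d) auto
      ultimately show ?thesis using d(2) iter[OF z] by simp
    next
      case False
      then have sd: "Suc s < d" using s by simp
      then have "w = (p ^^ (d - 1 - Suc s)) z" by (simp add: w_def)
      moreover have "?xs ! s = (p ^^ (Suc (d - 1 - Suc s))) z"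
        using sd by (simp add: Suc_diff_Suc)
      ultimately show ?thesis using iter[OF z] by simp
    qed
    then have "w \<in> T" "?xs ! s = p w" by auto
    then show ?thesis unfolding w_def[symmetric] using p[of w] by (simp add: insert_commute)
  qed
  have "oriented_cycle S \<mu> ?xs"
    unfolding oriented_cycle_def
  proof (intro conjI allI impI dist)
    show "1 < length ?xs" using d1 by simp
    show "set ?xs \<subseteq> S" using iter[OF z] T by auto
    show "ori \<mu> {?xs ! s, ?xs ! (Suc s mod length ?xs)} = (?xs ! s, ?xs ! (Suc s mod length ?xs))"
      if "s < length ?xs" for s
      unfolding ori_def step[OF that] by simp
  qed
  moreover have "monochromatic \<mu> ?xs"
    unfolding monochromatic_def lab_def using step by auto
  ultimately show False using \<mu> by (auto simp: Ke_objs_def)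
qed

section \<open>The involution reversing the order of the labels\<close>

definition reverse_labels :: "nat \<Rightarrow> 'a set \<Rightarrow> 'a graph_obj \<Rightarrow> 'a graph_obj" where
  "reverse_labels n S \<mu> = (\<lambda>e\<in>edges S. (n + 1 - lab \<mu> e, ori \<mu> e))"

lemma reverse_labels_edge:
  assumes "e \<in> edges S"
  shows "lab (reverse_labels n S \<mu>) e = n + 1 - lab \<mu> e" "ori (reverse_labels n S \<mu>) e = ori \<mu> e"
  using assms by (simp_all add: reverse_labels_def lab_def ori_def)

lemma reverse_labels_G_objs:
  assumes "\<mu> \<in> G_objs n S"
  shows "reverse_labels n S \<mu> \<in> G_objs n S"
proof -
  have "lab (reverse_labels n S \<mu>) {x, y} \<in> {1..n} \<and> ori (reverse_labels n S \<mu>) {x, y} \<in> {(x, y), (y, x)}"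
    if "x \<in> S" "y \<in> S" "x \<noteq> y" for x y
    using that G_objsD[OF assms that] reverse_labels_edge[of "{x, y}" S n \<mu>] by (auto simp: pair_in_edges)
  then show ?thesis by (auto simp: G_objs_def reverse_labels_def)
qed

lemma G_objs_edge: "\<mu> \<in> G_objs n S \<Longrightarrow> e \<in> edges S \<Longrightarrow> 1 \<le> lab \<mu> e \<and> lab \<mu> e \<le> n"
  using labelled_ge_edge[OF labelled_ge_G_objs] by blast

lemma reverse_labels_twice:
  assumes "\<mu> \<in> G_objs n S"
  shows "reverse_labels n S (reverse_labels n S \<mu>) = \<mu>"
proof
  fix e
  show "reverse_labels n S (reverse_labels n S \<mu>) e = \<mu> e"
  proof (cases "e \<in> edges S")
    case True
    then show ?thesis
      using G_objs_edge[OF assms True] reverse_labels_edge[OF True, of n]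
      by (auto simp: prod_eq_iff simp flip: lab_def ori_def)
  next
    case False
    then show ?thesis using assms by (simp add: reverse_labels_def G_objs_def extensional_def)
  qed
qed

text \<open>Whether two orientations agree only decides between a weak and a strict comparison of
  labels, so reversing labels with the orientations kept reverses the order.\<close>

lemma reverse_labels_G_le:
  assumes "\<mu> \<in> G_objs n S" "\<nu> \<in> G_objs n S"
  shows "G_le S (reverse_labels n S \<mu>) (reverse_labels n S \<nu>) \<longleftrightarrow> G_le S \<nu> \<mu>"
proof -
  have "(n + 1 - lab \<mu> e \<le> n + 1 - lab \<nu> e) = (lab \<nu> e \<le> lab \<mu> e)"
    "(n + 1 - lab \<mu> e < n + 1 - lab \<nu> e) = (lab \<nu> e < lab \<mu> e)" if "e \<in> edges S" for e
    using G_objs_edge[OF assms(1) that] G_objs_edge[OF assms(2) that] by auto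
  then show ?thesis unfolding G_le_def by (auto simp: reverse_labels_edge)
qed

lemma reverse_labels_level_acyclic:
  assumes "\<mu> \<in> G_objs n S" "level_acyclic S \<mu>"
  shows "level_acyclic S (reverse_labels n S \<mu>)"
  unfolding level_acyclic_def
proof (intro allI impI)
  fix l T assume T: "T \<subseteq> S" "T \<noteq> {}"
  then obtain x where x: "x \<in> sources (n + 1 - l) T \<mu>"
    using assms(2) unfolding level_acyclic_def by blast
  have "reverse_labels n S \<mu> {x, y} \<noteq> (l, y, x)" if y: "y \<in> T" "y \<noteq> x" for y
  proof
    assume eq: "reverse_labels n S \<mu> {x, y} = (l, y, x)"
    have e: "{x, y} \<in> edges S" using x y T by (auto simp: sources_def pair_in_edges)
    have "n + 1 - lab \<mu> {x, y} = l" "ori \<mu> {x, y} = (y, x)"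
      using reverse_labels_edge[OF e, of n \<mu>] eq by (simp_all add: lab_def ori_def)
    then have "\<mu> {x, y} = (n + 1 - l, y, x)"
      using G_objs_edge[OF assms(1) e] by (auto simp: prod_eq_iff simp flip: lab_def ori_def)
    then show False using x y by (auto simp: sources_def)
  qed
  then have "x \<in> sources l T (reverse_labels n S \<mu>)" using x by (auto simp: sources_def)
  then show "sources l T (reverse_labels n S \<mu>) \<noteq> {}" by auto
qed

lemma reverse_labels_graph_box:
  assumes "S1 \<inter> S2 = {}"
  shows "reverse_labels n (S1 \<union> S2) (graph_box S1 S2 i \<mu>1 \<mu>2) =
    graph_box S1 S2 (n + 1 - i) (reverse_labels n S1 \<mu>1) (reverse_labels n S2 \<mu>2)"
proof
  fix e
  show "reverse_labels n (S1 \<union> S2) (graph_box S1 S2 i \<mu>1 \<mu>2) e =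
    graph_box S1 S2 (n + 1 - i) (reverse_labels n S1 \<mu>1) (reverse_labels n S2 \<mu>2) e"
  proof (cases "e \<in> edges (S1 \<union> S2)")
    case True
    then show ?thesis
    proof (cases rule: edges_Un)
      case 1
      then show ?thesis using True by (simp add: reverse_labels_def graph_box_left lab_def ori_def)
    next
      case 2
      then show ?thesis using True assms by (simp add: reverse_labels_def graph_box_right lab_def ori_def)
    next
      case (3 x y)
      then show ?thesis using True graph_box_cross[OF assms 3(1,2)]
        by (simp add: reverse_labels_def lab_def ori_def)
    qed
  qed (simp add: reverse_labels_def graph_box_def)
qed

text \<open>The index of \<open>M_up\<close> bounds the labels from above and drops to the label of
  the box in the recursion. It corresponds to a lower bound \<open>k\<close> on the labels on the
  other side, which must vary in the induction.\<close>

lemma M_down_imp_M_up: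
  assumes "M_down n S \<mu>" "1 \<le> k" "k \<le> n" "\<forall>e\<in>edges S. k \<le> lab \<mu> e"
  shows "M_up (n + 1 - k) S (reverse_labels n S \<mu>)"
  using assms
proof (induction arbitrary: k rule: M_down.induct)
  case (M_down_small S)
  then have "reverse_labels n S (\<lambda>_. undefined) = (\<lambda>_. undefined)"
    by (simp add: reverse_labels_def edges_small restrict_def)
  then show ?case using M_up.M_up_small[OF M_down_small.hyps] by simp
next
  case (M_down_box S S1 S2 i \<mu>1 \<mu>2)
  have part: "S1 \<inter> S2 = {}" "S1 \<union> S2 = S" "S1 \<noteq> {}" "S2 \<noteq> {}"
    using M_down_box.hyps(2) by (auto simp: ordered_partition_def)
  obtain x y where "x \<in> S1" "y \<in> S2" using part by auto
  then have "{x, y} \<in> edges S" "lab (graph_box S1 S2 i \<mu>1 \<mu>2) {x, y} = i"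
    using part graph_box_cross[of S1 S2 x y i \<mu>1 \<mu>2] by (auto simp: pair_in_edges lab_def)
  \<comment> \<open>Both blocks are nonempty, so some edge carries the label \<open>i\<close> of the
    box; this gives \<open>n + 1 - i \<le> n + 1 - k\<close>.\<close>
  then have "k \<le> i" using M_down_box.prems(3) by force
  have "M_up (n + 1 - k) S (graph_box S1 S2 (n + 1 - i) (reverse_labels n S1 \<mu>1) (reverse_labels n S2 \<mu>2))"
  proof (rule M_up.M_up_box)
    show "M_up (n + 1 - i) S1 (reverse_labels n S1 \<mu>1)" "M_up (n + 1 - i) S2 (reverse_labels n S2 \<mu>2)"
      using M_down_box.IH[of i] M_down_box.hyps by auto
  qed (use M_down_box.hyps \<open>k \<le> i\<close> in auto)
  then show ?case using reverse_labels_graph_box[OF part(1)] part(2) by metis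
qed

lemma contractible_above:
  assumes n: "1 \<le> n" and fin: "finite S"
    and A: "A \<subseteq> G_objs n S" "\<And>a. a \<in> A \<Longrightarrow> level_acyclic S a"
    and M: "M_up_objs n S \<subseteq> A" and b: "b \<in> G_objs n S" "level_acyclic S b"
  shows "contractible_poset (G_le S) {a \<in> A. G_le S b a}"
proof -
  let ?r = "reverse_labels n S"
  have rr: "?r (?r \<mu>) = \<mu>" if "\<mu> \<in> G_objs n S" for \<mu> using reverse_labels_twice that .
  have le: "G_le S (?r \<mu>) (?r \<nu>) \<longleftrightarrow> G_le S \<nu> \<mu>" if "\<mu> \<in> G_objs n S" "\<nu> \<in> G_objs n S" for \<mu> \<nu>
    using reverse_labels_G_le that .
  \<comment> \<open>The involution sends \<open>M_down\<close> into \<open>M_up\<close>, hence into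
    \<open>A\<close>, and applying it again returns to \<open>M_down\<close>.\<close>
  have "M_down_objs n S \<subseteq> ?r ` A"
  proof
    fix \<nu> assume \<nu>: "\<nu> \<in> M_down_objs n S"
    then have "M_up n S (?r \<nu>)"
      using M_down_imp_M_up[of n S \<nu> 1] n G_objs_edge[OF M_down_G_objs] by (auto simp: M_down_objs_def)
    then have "?r \<nu> \<in> A" using M by (auto simp: M_up_objs_def)
    moreover have "\<nu> = ?r (?r \<nu>)" using rr[of \<nu>] M_down_G_objs[of n S \<nu>] \<nu> by (simp add: M_down_objs_def)
    ultimately show "\<nu> \<in> ?r ` A" by blast
  qed
  then have "contractible_poset (G_le S) {a \<in> ?r ` A. G_le S a (?r b)}"
    using A b by (intro contractible_below[OF fin, of _ n])
      (auto simp: reverse_labels_G_objs intro: reverse_labels_level_acyclic)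
  also have "{a \<in> ?r ` A. G_le S a (?r b)} = ?r ` {a \<in> A. G_le S b a}"
    using le A b by blast
  finally have "contractible_poset (G_le S) (?r ` {a \<in> A. G_le S b a})" .
  moreover have "contractible_poset (G_le S) (?r ` {a \<in> A. G_le S b a}) \<longleftrightarrow>
      contractible_poset (G_le S) {a \<in> A. G_le S b a}"
  proof (rule contractible_poset_image)
    show "inj_on ?r {a \<in> A. G_le S b a}"
      by (rule inj_on_inverseI[of _ ?r]) (use rr A in auto)
    show "comparable (G_le S) (?r x) (?r y) \<longleftrightarrow> comparable (G_le S) x y"
      if "x \<in> {a \<in> A. G_le S b a}" "y \<in> {a \<in> A. G_le S b a}" for x y
      using le[of x y] le[of y x] that A by (auto simp: comparable_def)
  qed
  ultimately show ?thesis by simp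
qed

section \<open>Realizing a finite poset category\<close>

lemma continuous_map_from_sum_topology:
  assumes "\<And>i. i \<in> I \<Longrightarrow> continuous_map (X i) Y (\<lambda>x. f (i, x))"
  shows "continuous_map (sum_topology X I) Y f"
  unfolding continuous_map_def
proof (intro conjI allI impI)
  show "f \<in> topspace (sum_topology X I) \<rightarrow> topspace Y"
    using continuous_map_image_subset_topspace[OF assms] by fastforce
  fix U assume "openin Y U"
  then have "openin (X i) {x \<in> topspace (X i). f (i, x) \<in> U}" if "i \<in> I" for i
    using assms[OF that] by (auto simp: continuous_map_def)
  moreover have "{x. (i, x) \<in> topspace (sum_topology X I) \<and> f (i, x) \<in> U} =
      {x \<in> topspace (X i). f (i, x) \<in> U}" if "i \<in> I" for i
    using that by auto
  ultimately show "openin (sum_topology X I) {p \<in> topspace (sum_topology X I). f p \<in> U}"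
    by (auto simp: openin_sum_topology)
qed

lemma realization_equiv_glue:
  assumes "(p, p') \<in> realization_glue X"
  shows "realization_equiv X `` {p} = realization_equiv X `` {p'}"
proof -
  let ?S = "realization_glue X \<union> (realization_glue X)\<inverse>"
  have "(p, p') \<in> ?S" "(p', p) \<in> ?S" using assms by auto
  then have "(p, x) \<in> ?S\<^sup>* \<longleftrightarrow> (p', x) \<in> ?S\<^sup>*" for x
    by (meson converse_rtrancl_into_rtrancl)
  then show ?thesis unfolding realization_equiv_def Image_singleton by simp
qed

definition arrow_le :: "('o, 'm) category \<Rightarrow> 'o \<Rightarrow> 'o \<Rightarrow> bool" where
  "arrow_le C x y \<longleftrightarrow> (\<exists>f\<in>arrs C. src C f = x \<and> tgt C f = y)"

text \<open>Comma categories store their arrows as triples and so are not literally of the form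
  \<open>poset_cat\<close>; what is kept of a poset is thinness and the order
  \<open>arrow_le\<close> on objects.\<close>

locale finite_poset_category =
  fixes C :: "('o, 'm) category"
  assumes cat: "is_category C"
    and thin: "\<And>f g. f \<in> arrs C \<Longrightarrow> g \<in> arrs C \<Longrightarrow> src C f = src C g \<Longrightarrow> tgt C f = tgt C g \<Longrightarrow> f = g"
    and poset: "poset_on (objs C) (arrow_le C)"
    and fin: "finite (objs C)"
begin

abbreviation "R \<equiv> arrow_le C"

definition arrow :: "'o \<Rightarrow> 'o \<Rightarrow> 'm" where
  "arrow x y = (SOME f. f \<in> arrs C \<and> src C f = x \<and> tgt C f = y)"

lemma arrow:
  assumes "R x y"
  shows "arrow x y \<in> arrs C" "src C (arrow x y) = x" "tgt C (arrow x y) = y"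
  using someI_ex[of "\<lambda>f. f \<in> arrs C \<and> src C f = x \<and> tgt C f = y"] assms
  unfolding arrow_def arrow_le_def by blast+

lemma arrow_eq:
  assumes "f \<in> arrs C"
  shows "f = arrow (src C f) (tgt C f)"
proof -
  have "R (src C f) (tgt C f)" using assms by (auto simp: arrow_le_def)
  from arrow[OF this] show ?thesis by (intro thin assms) simp_all
qed

text \<open>In a thin category a simplex of the nerve is determined by its vertices. The
  restrictions produce the extensional representative that \<open>nerve\<close> requires.\<close>

definition chain_simplex :: "nat \<Rightarrow> (nat \<Rightarrow> 'o) \<Rightarrow> (nat \<Rightarrow> 'o) \<times> (nat \<times> nat \<Rightarrow> 'm)" where
  "chain_simplex k c = (restrict c {..k}, restrict (\<lambda>(i, j). arrow (c i) (c j)) (arrs (ord_cat k)))"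

lemma arrs_ord_cat: "(i, j) \<in> arrs (ord_cat k) \<longleftrightarrow> i \<le> j \<and> j \<le> k"
  by (auto simp: ord_cat_def poset_cat_def)

lemma chain_simplex_cong: "(\<And>i. i \<le> k \<Longrightarrow> c i = c' i) \<Longrightarrow> chain_simplex k c = chain_simplex k c'"
  unfolding chain_simplex_def by (auto simp: fun_eq_iff restrict_def arrs_ord_cat)

lemma chain_simplex_in:
  assumes "\<And>i. i \<le> k \<Longrightarrow> c i \<in> objs C" "\<And>i j. i \<le> j \<Longrightarrow> j \<le> k \<Longrightarrow> R (c i) (c j)"
  shows "chain_simplex k c \<in> simps (nerve C) k"
proof -
  have idn: "arrow x x = idn C x" if "x \<in> objs C" for x
    using cat that arrow_eq[of "idn C x"] by (auto simp: is_category_def)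
  have cmp: "arrow x z = cmp C (arrow y z) (arrow x y)" if "R x y" "R y z" for x y z
    using cat arrow[OF that(1)] arrow[OF that(2)] arrow_eq[of "cmp C (arrow y z) (arrow x y)"]
    by (auto simp: is_category_def)
  have "is_functor (ord_cat k) C (chain_simplex k c)"
    unfolding is_functor_def chain_simplex_def
    using assms arrow[OF assms(2)] idn cmp
    by (auto simp: ord_cat_def poset_cat_def)
  then show ?thesis by (auto simp: nerve_def chain_simplex_def)
qed

lemma simpsD:
  assumes F: "F \<in> simps (nerve C) k"
  shows "i \<le> k \<Longrightarrow> fst F i \<in> objs C" "i \<le> j \<Longrightarrow> j \<le> k \<Longrightarrow> R (fst F i) (fst F j)"
    "F = chain_simplex k (fst F)"
proof -
  have func: "is_functor (ord_cat k) C F" and exten: "fst F \<in> extensional {..k}"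
    "snd F \<in> extensional (arrs (ord_cat k))" using F by (auto simp: nerve_def)
  have arr: "snd F (i, j) \<in> arrs C" "src C (snd F (i, j)) = fst F i" "tgt C (snd F (i, j)) = fst F j"
    if "i \<le> j" "j \<le> k" for i j
  proof -
    have ij: "(i, j) \<in> arrs (ord_cat k)" using that by (simp add: arrs_ord_cat)
    then show "snd F (i, j) \<in> arrs C" using func unfolding is_functor_def by blast
    have "src C (snd F (i, j)) = fst F (src (ord_cat k) (i, j)) \<and>
        tgt C (snd F (i, j)) = fst F (tgt (ord_cat k) (i, j))"
      using func ij unfolding is_functor_def by blast
    then show "src C (snd F (i, j)) = fst F i" "tgt C (snd F (i, j)) = fst F j"
      by (simp_all add: ord_cat_def poset_cat_def)
  qed
  have "fst F ` objs (ord_cat k) \<subseteq> objs C" using func unfolding is_functor_def by blast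
  then show "i \<le> k \<Longrightarrow> fst F i \<in> objs C" by (auto simp: ord_cat_def poset_cat_def)
  show "i \<le> j \<Longrightarrow> j \<le> k \<Longrightarrow> R (fst F i) (fst F j)"
    using arr unfolding arrow_le_def by blast
  have "snd F (i, j) = arrow (fst F i) (fst F j)" if "i \<le> j" "j \<le> k" for i j
    using arrow_eq[OF arr(1)[OF that]] unfolding arr(2,3)[OF that] .
  then have "snd F e = snd (chain_simplex k (fst F)) e" for e
    using exten(2) by (cases e) (auto simp: chain_simplex_def extensional_def arrs_ord_cat)
  then have "snd F = snd (chain_simplex k (fst F))" by (rule ext)
  moreover have "fst F = fst (chain_simplex k (fst F))"
    using exten(1) by (simp add: chain_simplex_def extensional_restrict)
  ultimately show "F = chain_simplex k (fst F)" by (rule prod_eqI[rotated])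
qed

lemma sop_chain_simplex:
  assumes "ord_map m k \<theta>"
  shows "sop (nerve C) m k \<theta> (chain_simplex k c) = chain_simplex m (c \<circ> \<theta>)"
proof -
  have "\<theta> i \<le> k" if "i \<le> m" for i using assms that by (auto simp: ord_map_def)
  moreover have "\<theta> i \<le> \<theta> j" if "i \<le> j" "j \<le> m" for i j
    using assms that by (auto simp: ord_map_def mono_on_def)
  ultimately show ?thesis
    by (auto simp: nerve_def chain_simplex_def fun_eq_iff restrict_def arrs_ord_cat)
qed

definition chains :: "'o set set" where
  "chains = {Z. Z \<subseteq> objs C \<and> Z \<noteq> {} \<and> (\<forall>x\<in>Z. \<forall>y\<in>Z. comparable R x y)}"

lemma chain_enumeration:
  assumes "finite Z" "Z \<subseteq> objs C" "\<forall>x\<in>Z. \<forall>y\<in>Z. comparable R x y"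
  shows "\<exists>e. bij_betw e {..<card Z} Z \<and> (\<forall>i j. i \<le> j \<longrightarrow> j < card Z \<longrightarrow> R (e i) (e j))"
  using assms
proof (induction Z rule: finite_psubset_induct)
  case (psubset Z)
  show ?case
  proof (cases "Z = {}")
    case False
    have "poset_on Z R\<inverse>\<inverse>"
      using poset_on_subset[OF poset psubset.prems(1)] by (simp add: poset_on_conversep)
    from poset_on_minimal[OF this psubset.hyps False]
    obtain m where m: "m \<in> Z" "\<And>x. x \<in> Z \<Longrightarrow> R\<inverse>\<inverse> x m \<Longrightarrow> x = m" by blast
    have top: "R x m" if x: "x \<in> Z" for x
    proof (cases "R m x")
      case True
      then have "x = m" using m(2)[OF x] by simp
      then show ?thesis using True by simp
    next
      case False
      then show ?thesis using psubset.prems(2) x m(1) unfolding comparable_def by blast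
    qed
    define N where "N = card (Z - {m})"
    have cZ: "card Z = Suc N"
      unfolding N_def using m(1) psubset.hyps by (metis card_Suc_Diff1)
    have "\<exists>e. bij_betw e {..<N} (Z - {m}) \<and>
        (\<forall>i j. i \<le> j \<longrightarrow> j < N \<longrightarrow> R (e i) (e j))"
      unfolding N_def by (rule psubset.IH) (use m(1) psubset.prems in auto)
    then obtain e where e: "bij_betw e {..<N} (Z - {m})"
      "\<And>i j. i \<le> j \<Longrightarrow> j < N \<Longrightarrow> R (e i) (e j)"
      by auto
    let ?e = "e(N := m)"
    have "bij_betw ?e {..<N} (Z - {m})"
      using e(1) bij_betw_cong[of "{..<N}" ?e e] by simp
    moreover have "?e N = m" by simp
    ultimately have "bij_betw ?e (insert N {..<N}) (insert m (Z - {m}))"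
      using notIn_Un_bij_betw[of N "{..<N}" ?e "Z - {m}"] by simp
    then have bij: "bij_betw ?e {..<card Z} Z"
      using m(1) by (simp add: cZ lessThan_Suc insert_absorb)
    have "R (?e i) (?e j)" if "i \<le> j" "j < card Z" for i j
    proof (cases "j = N")
      case True
      have "?e i \<in> Z" by (rule bij_betw_apply[OF bij]) (use that in simp)
      then show ?thesis using top True by simp
    next
      case False
      then show ?thesis using e(2)[of i j] that cZ by auto
    qed
    then show ?thesis using bij by blast
  qed (auto simp: bij_betw_def)
qed

definition enum :: "'o set \<Rightarrow> nat \<Rightarrow> 'o" where
  "enum Z = (SOME e. bij_betw e {..<card Z} Z \<and> (\<forall>i j. i \<le> j \<longrightarrow> j < card Z \<longrightarrow> R (e i) (e j)))"

lemma enum: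
  assumes "Z \<in> chains"
  shows "bij_betw (enum Z) {..<card Z} Z" "i \<le> j \<Longrightarrow> j < card Z \<Longrightarrow> R (enum Z i) (enum Z j)"
    "0 < card Z" "Z \<subseteq> objs C"
proof -
  have "finite Z" "Z \<noteq> {}" "Z \<subseteq> objs C" using assms finite_subset[OF _ fin] by (auto simp: chains_def)
  then show "0 < card Z" "Z \<subseteq> objs C" by (auto simp: card_gt_0_iff)
  have "bij_betw (enum Z) {..<card Z} Z \<and> (\<forall>i j. i \<le> j \<longrightarrow> j < card Z \<longrightarrow> R (enum Z i) (enum Z j))"
    unfolding enum_def
    by (rule someI_ex[OF chain_enumeration]) (use assms \<open>finite Z\<close> in \<open>auto simp: chains_def\<close>)
  then show "bij_betw (enum Z) {..<card Z} Z" "i \<le> j \<Longrightarrow> j < card Z \<Longrightarrow> R (enum Z i) (enum Z j)"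
    by auto
qed

text \<open>The nondegenerate simplex with vertex set \<open>Z\<close>; a chain of
  \<open>card Z\<close> elements has dimension \<open>card Z - 1\<close>.\<close>

abbreviation "top_simplex Z \<equiv> chain_simplex (card Z - 1) (enum Z)"

lemma enum_eq_iff: "Z \<in> chains \<Longrightarrow> i < card Z \<Longrightarrow> j < card Z \<Longrightarrow> enum Z i = enum Z j \<longleftrightarrow> i = j"
  using bij_betw_imp_inj_on[OF enum(1)] by (meson inj_onD lessThan_iff)

lemma top_simplex_apply:
  assumes "Z \<in> chains"
  shows "i \<le> card Z - 1 \<longleftrightarrow> i < card Z" "i < card Z \<Longrightarrow> fst (top_simplex Z) i = enum Z i"
  using enum(3)[OF assms] by (auto simp: chain_simplex_def)

lemma top_simplex_in: "Z \<in> chains \<Longrightarrow> top_simplex Z \<in> simps (nerve C) (card Z - 1)"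
  using enum[of Z] by (intro chain_simplex_in) (auto simp: bij_betw_def)

section \<open>Comparison of the quotient with barycentric coordinates\<close>

abbreviation "GR \<equiv> geometric_realization (nerve C)"
abbreviation "geo \<equiv> flag_realization (comparable R) (objs C)"
abbreviation "cls \<equiv> \<lambda>p. realization_equiv (nerve C) `` {p}"

text \<open>Vertices of a simplex may repeat; adding up the weights of equal vertices gives
  barycentric coordinates that do not change under gluing.\<close>

definition spread :: "(nat \<times> (nat \<Rightarrow> 'o) \<times> (nat \<times> nat \<Rightarrow> 'm)) \<times> (nat \<Rightarrow> real) \<Rightarrow> 'o \<Rightarrow> real" where
  "spread = (\<lambda>((k, F), t) x. \<Sum>i | i \<le> k \<and> fst F i = x. t i)"

definition coords :: "'o set \<Rightarrow> ('o \<Rightarrow> real) \<Rightarrow> nat \<Rightarrow> real" where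
  "coords Z s = (\<lambda>i. if i < card Z then s (enum Z i) else 0)"

definition point :: "'o set \<Rightarrow> ('o \<Rightarrow> real) \<Rightarrow> (nat \<times> (nat \<Rightarrow> 'o) \<times> (nat \<times> nat \<Rightarrow> 'm)) \<times> (nat \<Rightarrow> real)" where
  "point Z s = ((card Z - 1, top_simplex Z), coords Z s)"

lemma spread_point:
  assumes Z: "Z \<in> chains"
  shows "spread (point Z s) x = (if x \<in> Z then s x else 0)"
proof -
  have "j \<le> card Z - 1 \<and> fst (top_simplex Z) j = x \<longleftrightarrow> j < card Z \<and> enum Z j = x" for j
  proof (cases "j < card Z")
    case True
    show ?thesis unfolding top_simplex_apply(1)[OF Z] top_simplex_apply(2)[OF Z True] ..
  qed (simp only: top_simplex_apply(1)[OF Z] simp_thms)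
  then have eq: "spread (point Z s) x = (\<Sum>j | j < card Z \<and> enum Z j = x. coords Z s j)"
    unfolding point_def spread_def prod.case fst_conv by (simp only:)
  show ?thesis
  proof (cases "x \<in> Z")
    case True
    then have "x \<in> enum Z ` {..<card Z}"
      by (simp only: bij_betw_imp_surj_on[OF enum(1)[OF Z]])
    then obtain i where i: "i < card Z" "enum Z i = x" by auto
    then have "{j. j < card Z \<and> enum Z j = x} = {i}"
      using enum_eq_iff[OF Z _ i(1)] by auto
    then have "spread (point Z s) x = coords Z s i" unfolding eq by simp
    then show ?thesis using i True by (simp add: coords_def)
  next
    case False
    then have "\<not> (j < card Z \<and> enum Z j = x)" for j
      using bij_betw_apply[OF enum(1)[OF Z], of j] by (metis lessThan_iff)
    then have "{j. j < card Z \<and> enum Z j = x} = {}" by blast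
    then show ?thesis using False unfolding eq by (simp only: sum.empty if_False)
  qed
qed

lemma topspace_sum:
  "topspace (realization_sum (nerve C)) =
     {((k, F), t) | k F t. F \<in> simps (nerve C) k \<and> t \<in> standard_simplex k}"
  by (auto simp: realization_sum_def)

text \<open>Sending each index of \<open>F\<close> to the position of its vertex in the enumeration
  of \<open>Z\<close> is a monotone map \<open>\<theta>\<close> that pulls
  \<open>top_simplex Z\<close> back to \<open>F\<close>. Faces and degeneracies are thus handled by
  a single gluing.\<close>

lemma cls_eq_point:
  assumes F: "F \<in> simps (nerve C) k" and t: "t \<in> standard_simplex k"
    and Z: "Z \<in> chains" "fst F ` {..k} \<subseteq> Z"
  shows "cls ((k, F), t) = cls (point Z (spread ((k, F), t)))"
proof -
  note e = enum[OF Z(1)]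
  define \<theta> where "\<theta> i = inv_into {..<card Z} (enum Z) (fst F i)" for i
  have \<theta>: "\<theta> i < card Z" "enum Z (\<theta> i) = fst F i" if "i \<le> k" for i
  proof -
    have "fst F i \<in> enum Z ` {..<card Z}" using e(1) Z(2) that by (auto simp: bij_betw_def)
    then show "\<theta> i < card Z" "enum Z (\<theta> i) = fst F i"
      unfolding \<theta>_def using inv_into_into f_inv_into_f by (metis lessThan_iff)+
  qed
  have inj: "i = j" if "i < card Z" "j < card Z" "enum Z i = enum Z j" for i j
    using e(1) that by (auto simp: bij_betw_def inj_on_def)
  have mono: "\<theta> i \<le> \<theta> j" if "i \<le> j" "j \<le> k" for i j
  proof (rule ccontr)
    assume "\<not> \<theta> i \<le> \<theta> j"
    then have "R (fst F j) (fst F i)" using e(2)[of "\<theta> j" "\<theta> i"] \<theta>[of i] \<theta>[of j] that by auto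
    moreover have "R (fst F i) (fst F j)" using simpsD(2)[OF F that] .
    ultimately have "fst F i = fst F j"
      using poset_onD(2)[OF poset] simpsD(1)[OF F] that by auto
    then have "\<theta> i = \<theta> j" by (simp add: \<theta>_def)
    then show False using \<open>\<not> \<theta> i \<le> \<theta> j\<close> by simp
  qed
  have ord: "ord_map k (card Z - 1) \<theta>"
    unfolding ord_map_def mono_on_def using mono \<theta>(1) e(3) by fastforce
  have "sop (nerve C) k (card Z - 1) \<theta> (top_simplex Z) = chain_simplex k (enum Z \<circ> \<theta>)"
    by (rule sop_chain_simplex[OF ord])
  also have "\<dots> = chain_simplex k (fst F)" by (rule chain_simplex_cong) (use \<theta>(2) in auto)
  also have "\<dots> = F" by (rule simpsD(3)[OF F, symmetric])
  finally have F_eq: "sop (nerve C) k (card Z - 1) \<theta> (top_simplex Z) = F" .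
  have "simplex_push k \<theta> t j = coords Z (spread ((k, F), t)) j" for j
  proof (cases "j < card Z")
    case True
    have "{i. i \<le> k \<and> \<theta> i = j} = {i. i \<le> k \<and> fst F i = enum Z j}"
      using \<theta> inj True by metis
    then show ?thesis using True by (simp add: simplex_push_def coords_def spread_def)
  next
    case False
    then have "{i. i \<le> k \<and> \<theta> i = j} = {}" using \<theta>(1) by auto
    then have "simplex_push k \<theta> t j = 0" unfolding simplex_push_def by (simp only: sum.empty)
    then show ?thesis using False by (simp add: coords_def)
  qed
  then have push: "simplex_push k \<theta> t = coords Z (spread ((k, F), t))" by (rule ext)
  have "(((k, sop (nerve C) k (card Z - 1) \<theta> (top_simplex Z)), t),
      ((card Z - 1, top_simplex Z), simplex_push k \<theta> t)) \<in> realization_glue (nerve C)"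
    unfolding realization_glue_def using ord top_simplex_in[OF Z(1)] t by blast
  then have "(((k, F), t), point Z (spread ((k, F), t))) \<in> realization_glue (nerve C)"
    unfolding F_eq push point_def .
  then show ?thesis by (rule realization_equiv_glue)
qed

lemma spread_glue:
  assumes "(p, p') \<in> realization_glue (nerve C)"
  shows "spread p = spread p'"
proof -
  obtain m k \<theta> F t where o: "ord_map m k \<theta>" and p: "p = ((m, sop (nerve C) m k \<theta> F), t)"
    "p' = ((k, F), simplex_push m \<theta> t)"
    using assms unfolding realization_glue_def by auto
  have \<theta>: "\<theta> i \<le> k" if "i \<le> m" for i using o that by (auto simp: ord_map_def)
  show ?thesis
  proof
    fix x
    let ?A = "{i. i \<le> m \<and> fst F (\<theta> i) = x}" and ?B = "{j. j \<le> k \<and> fst F j = x}"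
    have "spread p' x = (\<Sum>j\<in>?B. \<Sum>i | i \<le> m \<and> \<theta> i = j. t i)"
      by (simp add: p spread_def simplex_push_def)
    also have "\<dots> = (\<Sum>j\<in>?B. sum t {i \<in> ?A. \<theta> i = j})"
      by (intro sum.cong refl) auto
    also have "\<dots> = sum t ?A"
      by (rule sum.group) (use \<theta> in auto)
    also have "\<dots> = spread p x"
      unfolding p spread_def by (auto simp: nerve_def intro!: sum.cong)
    finally show "spread p x = spread p' x" by simp
  qed
qed

lemma spread_equiv:
  assumes "(p, p') \<in> realization_equiv (nerve C)"
  shows "spread p = spread p'"
  using assms unfolding realization_equiv_def
proof (induction rule: rtrancl_induct)
  case (step y z)
  then show ?case using spread_glue[of y z] spread_glue[of z y] by auto
qed simp

lemma spread_support: "spread ((k, F), t) x \<noteq> 0 \<Longrightarrow> x \<in> fst F ` {..k}"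
proof (rule ccontr)
  assume "spread ((k, F), t) x \<noteq> 0" "x \<notin> fst F ` {..k}"
  moreover from this have "{i. i \<le> k \<and> fst F i = x} = {}" by auto
  then have "spread ((k, F), t) x = 0" unfolding spread_def prod.case by (simp only: sum.empty)
  ultimately show False by simp
qed

lemma image_chain:
  assumes "F \<in> simps (nerve C) k"
  shows "fst F ` {..k} \<in> chains"
proof -
  have "comparable R (fst F i) (fst F j)" if "i \<le> k" "j \<le> k" for i j
    using simpsD(2)[OF assms, of i j] simpsD(2)[OF assms, of j i] that
    by (cases "i \<le> j") (auto simp: comparable_def)
  then show ?thesis using simpsD(1)[OF assms] by (auto simp: chains_def)
qed

lemma spread_in:
  assumes F: "F \<in> simps (nerve C) k" and t: "t \<in> standard_simplex k"
  shows "spread ((k, F), t) \<in> geo"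
proof -
  have "sum (spread ((k, F), t)) (objs C) = (\<Sum>x\<in>objs C. sum t {i \<in> {..k}. fst F i = x})"
    by (simp add: spread_def)
  also have "\<dots> = sum t {..k}"
    by (rule sum.group) (use fin simpsD(1)[OF F] in auto)
  finally have "sum (spread ((k, F), t)) (objs C) = 1" using t by (simp add: standard_simplex_def)
  moreover have "0 \<le> spread ((k, F), t) x" for x
    using t by (auto simp: spread_def standard_simplex_def intro!: sum_nonneg)
  moreover have "x \<in> objs C" if "spread ((k, F), t) x \<noteq> 0" for x
    using spread_support[OF that] simpsD(1)[OF F] by blast
  moreover have "comparable R x y" if "spread ((k, F), t) x \<noteq> 0" "spread ((k, F), t) y \<noteq> 0" for x y
    using spread_support[OF that(1)] spread_support[OF that(2)] image_chain[OF F]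
    unfolding chains_def by blast
  ultimately show ?thesis unfolding flag_realization_def by blast
qed

lemma coords_in:
  assumes Z: "Z \<in> chains" and s: "s \<in> geo" and supp: "\<And>x. s x \<noteq> 0 \<Longrightarrow> x \<in> Z"
  shows "coords Z s \<in> standard_simplex (card Z - 1)" "spread (point Z s) = s"
proof -
  note e = enum[OF Z]
  have le: "i \<le> card Z - Suc 0 \<longleftrightarrow> i < card Z" for i using e(3) by auto
  have "(\<Sum>i\<le>card Z - 1. coords Z s i) = (\<Sum>i<card Z. s (enum Z i))"
    by (rule sum.cong) (auto simp: coords_def le)
  also have "\<dots> = sum s Z" by (rule sum.reindex_bij_betw[OF e(1)])
  also have "\<dots> = sum s (objs C)"
    by (rule sum.mono_neutral_left) (use fin e(4) supp in auto)
  finally have "(\<Sum>i\<le>card Z - 1. coords Z s i) = 1" using flag_realizationD(3)[OF s] by simp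
  moreover have "0 \<le> coords Z s i \<and> coords Z s i \<le> 1" for i
    unfolding coords_def using flag_realizationD(1)[OF s] flag_realization_le_1[OF fin s] by simp
  moreover have "coords Z s i = 0" if "card Z - 1 < i" for i
    using that by (simp add: coords_def)
  ultimately show "coords Z s \<in> standard_simplex (card Z - 1)"
    by (simp add: standard_simplex_def)
  show "spread (point Z s) = s"
    by (rule ext) (use spread_point[OF Z] supp in auto)
qed

lemma top_simplex_image:
  assumes Z: "Z \<in> chains"
  shows "fst (top_simplex Z) ` {..card Z - 1} = Z"
proof -
  have eq: "{..card Z - 1} = {..<card Z}" using top_simplex_apply(1)[OF Z] by blast
  have "fst (top_simplex Z) ` {..card Z - 1} = enum Z ` {..<card Z}"
    unfolding eq by (rule image_cong[OF refl]) (simp only: top_simplex_apply(2)[OF Z] lessThan_iff)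
  then show ?thesis using bij_betw_imp_surj_on[OF enum(1)[OF Z]] by simp
qed

lemma support_chain:
  assumes s: "s \<in> geo"
  shows "{x. s x \<noteq> 0} \<in> chains"
proof -
  have "sum s (objs C) \<noteq> 0" using flag_realizationD(3)[OF s] by simp
  then obtain x where "s x \<noteq> 0" by (meson sum.neutral)
  then show ?thesis using flag_realizationD(4,5)[OF s] by (auto simp: chains_def)
qed

text \<open>The simplex on the support of \<open>s\<close> is a face of the simplex on any chain
  \<open>Z\<close> containing it, so all choices of \<open>Z\<close> are compared through the
  support.\<close>

lemma point_consistent:
  assumes s: "s \<in> geo" and Z: "Z \<in> chains" "\<And>x. s x \<noteq> 0 \<Longrightarrow> x \<in> Z"
  shows "cls (point Z s) = cls (point {x. s x \<noteq> 0} s)"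
proof -
  let ?W = "{x. s x \<noteq> 0}"
  have W: "?W \<in> chains" by (rule support_chain[OF s])
  have c: "coords ?W s \<in> standard_simplex (card ?W - 1)" "spread (point ?W s) = s"
    by (rule coords_in[OF W s]; simp)+
  have "cls (point ?W s) = cls (point Z (spread (point ?W s)))"
    unfolding point_def[of ?W]
    by (rule cls_eq_point[OF top_simplex_in[OF W] c(1) Z(1)])
      (use top_simplex_image[OF W] Z(2) in auto)
  then show ?thesis using c(2) by simp
qed

lemma continuous_spread:
  "continuous_map (realization_sum (nerve C)) (top_of_set geo) spread"
  unfolding realization_sum_def
proof (rule continuous_map_from_sum_topology)
  fix i assume "i \<in> (SIGMA k:UNIV. simps (nerve C) k)"
  then obtain k F where i: "i = (k, F)" and F: "F \<in> simps (nerve C) k" by auto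
  have "continuous_on T (\<lambda>t. spread ((k, F), t))" for T
    by (rule continuous_on_coordinatewise_then_product)
      (auto simp: spread_def intro!: continuous_intros continuous_on_coordinate)
  then show "continuous_map (case i of (k, x) \<Rightarrow> subtopology (powertop_real UNIV) (standard_simplex k))
      (top_of_set geo) (\<lambda>t. spread (i, t))"
    using spread_in[OF F] by (auto simp: i euclidean_product_topology)
qed

lemma continuous_point:
  assumes Z: "Z \<in> chains"
  shows "continuous_map (subtopology (top_of_set geo) {s. \<forall>x. s x \<noteq> 0 \<longrightarrow> x \<in> Z}) GR (\<lambda>s. cls (point Z s))"
proof -
  let ?S = "geo \<inter> {s. \<forall>x. s x \<noteq> 0 \<longrightarrow> x \<in> Z}"
  have "continuous_on ?S (\<lambda>s. coords Z s i)" for i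
    by (cases "i < card Z") (simp_all add: coords_def continuous_on_coordinate)
  then have "continuous_on ?S (coords Z)"
    by (rule continuous_on_coordinatewise_then_product)
  then have "continuous_map (top_of_set ?S) (subtopology (powertop_real UNIV) (standard_simplex (card Z - 1))) (coords Z)"
    using coords_in(1)[OF Z] by (auto simp: euclidean_product_topology)
  moreover have "continuous_map (subtopology (powertop_real UNIV) (standard_simplex (card Z - 1)))
      (realization_sum (nerve C)) (\<lambda>t. ((card Z - 1, top_simplex Z), t))"
    using continuous_map_component_injection[of "(card Z - 1, top_simplex Z)" "SIGMA k:UNIV. simps (nerve C) k"
        "\<lambda>(k, x). subtopology (powertop_real UNIV) (standard_simplex k)"] top_simplex_in[OF Z]
    by (simp add: realization_sum_def)
  moreover have "continuous_map (realization_sum (nerve C)) GR cls"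
    unfolding geometric_realization_def
    by (rule quotient_imp_continuous_map[OF quotient_map_quotient_topology])
  ultimately have "continuous_map (top_of_set ?S) GR (cls \<circ> ((\<lambda>t. ((card Z - 1, top_simplex Z), t)) \<circ> coords Z))"
    by (intro continuous_map_compose)
  then show ?thesis by (simp add: subtopology_subtopology o_def point_def)
qed

text \<open>The points supported in a fixed chain form one of finitely many closed pieces of
  \<open>geo\<close>; on each of them \<open>point\<close> gives a continuous map to the quotient,
  and the pieces are pasted to \<open>g\<close>. As \<open>g\<close> undoes the map induced by
  \<open>spread\<close>, the quotient is a retract of \<open>geo\<close> and inherits
  contractibility.\<close>

theorem has_contractible_realization:
  assumes con: "contractible_poset R (objs C)"
  shows "has_contractible_realization C"
proof -
  let ?T = "\<lambda>Z. {s. \<forall>x. s x \<noteq> 0 \<longrightarrow> x \<in> Z}"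
  have qm: "quotient_map (realization_sum (nerve C)) GR cls"
    unfolding geometric_realization_def by (rule quotient_map_quotient_topology)
  have fin_chains: "finite chains"
    by (rule finite_subset[of _ "Pow (objs C)"]) (use fin in \<open>auto simp: chains_def\<close>)
  have cover: "topspace (top_of_set geo) \<subseteq> (\<Union>Z\<in>chains. geo \<inter> ?T Z)"
  proof
    fix s assume "s \<in> topspace (top_of_set geo)"
    then have s: "s \<in> geo" by simp
    show "s \<in> (\<Union>Z\<in>chains. geo \<inter> ?T Z)" by (rule UN_I[OF support_chain[OF s]]) (use s in auto)
  qed
  have clo: "closedin (top_of_set geo) (geo \<inter> ?T Z)" for Z
  proof -
    have "closed (\<Inter>x\<in>- Z. {s :: 'o \<Rightarrow> real. s x = 0})"
      by (intro closed_INT ballI closed_Collect_eq continuous_on_coordinate continuous_on_const)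
    moreover have "(\<Inter>x\<in>- Z. {s :: 'o \<Rightarrow> real. s x = 0}) = ?T Z" by auto
    ultimately show ?thesis by (simp add: closedin_closed_Int)
  qed
  have cont: "continuous_map (subtopology (top_of_set geo) (geo \<inter> ?T Z)) GR (\<lambda>s. cls (point Z s))"
    if "Z \<in> chains" for Z
    using continuous_point[OF that] by (simp add: subtopology_subtopology Int_assoc[symmetric])
  have cons: "cls (point Z s) = cls (point Z' s)"
    if "Z \<in> chains" "Z' \<in> chains" "s \<in> topspace (top_of_set geo) \<inter> (geo \<inter> ?T Z) \<inter> (geo \<inter> ?T Z')"
    for Z Z' s
  proof -
    have s: "s \<in> geo" "\<And>x. s x \<noteq> 0 \<Longrightarrow> x \<in> Z" "\<And>x. s x \<noteq> 0 \<Longrightarrow> x \<in> Z'" using that(3) by auto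
    show ?thesis
      by (rule trans[OF point_consistent[OF s(1) that(1) s(2)]
            point_consistent[OF s(1) that(2) s(3), symmetric]])
  qed
  obtain g where g: "continuous_map (top_of_set geo) GR g"
    and g_eq: "\<And>s Z. Z \<in> chains \<Longrightarrow> s \<in> topspace (top_of_set geo) \<inter> (geo \<inter> ?T Z) \<Longrightarrow> g s = cls (point Z s)"
    by (rule pasting_lemma_exists_closed[OF fin_chains cover clo cont cons]) blast+
  \<comment> \<open>The choice of a representative does not matter, since \<open>spread\<close> is
    constant on classes; continuity of \<open>f\<close> comes from the quotient map.\<close>
  define f where "f K = spread (SOME p. p \<in> K)" for K
  have f_cls: "f (cls p) = spread p" for p
  proof -
    have "p \<in> cls p" by (simp add: realization_equiv_def)
    then have "(SOME p'. p' \<in> cls p) \<in> cls p" by (rule someI)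
    then have "(p, SOME p'. p' \<in> cls p) \<in> realization_equiv (nerve C)" by simp
    then show ?thesis unfolding f_def by (rule spread_equiv[symmetric])
  qed
  have "continuous_map GR (top_of_set geo) f"
    using continuous_compose_quotient_map[OF qm, of "top_of_set geo" f] continuous_spread f_cls
    by (simp add: o_def)
  moreover have "g (f K) = K" if K: "K \<in> topspace GR" for K
  proof -
    have "K \<in> cls ` topspace (realization_sum (nerve C))"
      using K by (simp only: quotient_imp_surjective_map[OF qm])
    then obtain p where "K = cls p" "p \<in> topspace (realization_sum (nerve C))" by (rule imageE)
    then obtain k F t where F: "F \<in> simps (nerve C) k" and t: "t \<in> standard_simplex k"
      and K_eq: "K = cls ((k, F), t)" by (auto simp: topspace_sum)
    have Z: "fst F ` {..k} \<in> chains" by (rule image_chain[OF F])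
    have "g (spread ((k, F), t)) = cls (point (fst F ` {..k}) (spread ((k, F), t)))"
      by (rule g_eq[OF Z]) (use spread_in[OF F t] spread_support[of k F t] in auto)
    also have "\<dots> = K" unfolding K_eq by (rule cls_eq_point[OF F t Z order_refl, symmetric])
    finally show ?thesis by (simp add: K_eq f_cls)
  qed
  ultimately have "retraction_map (top_of_set geo) GR g"
    using g unfolding retraction_map_def retraction_maps_def by blast
  moreover have "contractible_space (top_of_set geo)"
    using con by (simp add: contractible_poset_def)
  ultimately have "contractible_space GR" by (metis contractible_space_retraction_map_image)
  moreover have "topspace GR \<noteq> {}"
  proof -
    obtain x where "x \<in> objs C" using con by (auto simp: contractible_poset_def)
    then have "geo \<noteq> {}"
      using vertex_in_flag_realization[OF fin, of x "comparable R"] poset_onD(1)[OF poset]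
      by (auto simp: comparable_def)
    then show ?thesis using continuous_map_image_subset_topspace[OF g] by auto
  qed
  ultimately show ?thesis by (simp add: has_contractible_realization_def)
qed

end

section \<open>Comma categories of an inclusion of posets\<close>

text \<open>Isolates what the over- and undercategory share: each is thin and its objects are
  parametrized by a poset \<open>X\<close> through an embedding \<open>h\<close>.\<close>

lemma has_contractible_realization_thin:
  assumes "is_category C"
    and "\<And>f g. f \<in> arrs C \<Longrightarrow> g \<in> arrs C \<Longrightarrow> src C f = src C g \<Longrightarrow> tgt C f = tgt C g \<Longrightarrow> f = g"
    and po: "poset_on X R" and con: "contractible_poset R X"
    and inj: "inj_on h X" and obj: "objs C = h ` X"
    and le: "\<And>x y. x \<in> X \<Longrightarrow> y \<in> X \<Longrightarrow> arrow_le C (h x) (h y) \<longleftrightarrow> R x y"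
  shows "has_contractible_realization C"
proof -
  have "poset_on (objs C) (arrow_le C)"
    unfolding poset_on_def obj
  proof (intro conjI reflp_onI antisymp_onI transp_onI)
    show "arrow_le C x x" if "x \<in> h ` X" for x
      using that le poset_onD(1)[OF po] by auto
    show "x = y" if tr: "x \<in> h ` X" "y \<in> h ` X" "arrow_le C x y" "arrow_le C y x" for x y
    proof -
      obtain a b where ab: "a \<in> X" "b \<in> X" "x = h a" "y = h b" using tr(1,2) by auto
      then have "R a b" "R b a" using tr(3,4) le by simp_all
      then show ?thesis using poset_onD(2)[OF po ab(1,2)] ab by simp
    qed
    show "arrow_le C x z" if tr: "x \<in> h ` X" "y \<in> h ` X" "z \<in> h ` X" "arrow_le C x y" "arrow_le C y z" for x y z
    proof -
      obtain a b c where abc: "a \<in> X" "b \<in> X" "c \<in> X" "x = h a" "y = h b" "z = h c"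
        using tr(1,2,3) by auto
      then have "R a b" "R b c" using tr(4,5) le by simp_all
      then show ?thesis using poset_onD(3)[OF po abc(1-3)] abc le by simp
    qed
  qed
  moreover have "contractible_poset (arrow_le C) (objs C)"
    unfolding obj using contractible_poset_image[OF inj, of "arrow_le C" R] le con
    by (simp add: comparable_def)
  moreover have "finite (objs C)" using calculation(2) by (simp add: contractible_poset_def)
  ultimately interpret finite_poset_category C using assms(1,2) by unfold_locales
  show ?thesis by (rule has_contractible_realization) fact
qed

text \<open>An object is stored as \<open>(a, (a, b))\<close>, the second entry being the arrow to
  \<open>b\<close>. So it is determined by \<open>a\<close>, and the overcategory is a copy of the
  elements of \<open>A\<close> below \<open>b\<close>.\<close>

lemma overcategory_contractible:
  assumes po: "poset_on B R" and AB: "A \<subseteq> B" and b: "b \<in> B"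
    and con: "contractible_poset R {a \<in> A. R a b}"
  shows "has_contractible_realization (overcategory (poset_cat A R) (poset_cat B R) inclusion_functor b)"
proof (rule has_contractible_realization_thin[OF _ _ _ con])
  let ?C = "overcategory (poset_cat A R) (poset_cat B R) inclusion_functor b"
  note defs = overcategory_def poset_cat_def inclusion_functor_def Let_def
  have R: "R x x" if "x \<in> A" for x using poset_onD(1)[OF po] AB that by blast
  have T: "R x z" if "x \<in> A" "y \<in> A" "z \<in> A" "R x y" "R y z" for x y z
    using poset_onD(3)[OF po, of x y z] AB that by blast
  have objs: "objs ?C = {(a, a, b) | a. a \<in> A \<and> R a b}"
    using AB b by (auto simp: defs)
  have arrs: "arrs ?C = {((a, a, b), (a, a'), (a', a', b)) | a a'. a \<in> A \<and> a' \<in> A \<and> R a b \<and> R a' b \<and> R a a'}"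
    using AB b by (auto simp: defs)
  have str: "src ?C (p, h, q) = p" "tgt ?C (p, h, q) = q" "idn ?C p = (p, (fst p, fst p), p)"
    "cmp ?C (q', k, r) (p, h, q) = (p, (fst h, snd k), r)" for p q q' r h k
    by (simp_all add: defs)
  show "is_category ?C"
    unfolding is_category_def objs arrs by (auto simp: str R intro: T)
  show "f = g" if "f \<in> arrs ?C" "g \<in> arrs ?C" "src ?C f = src ?C g" "tgt ?C f = tgt ?C g" for f g
    using that unfolding arrs by (auto simp: str)
  show "poset_on {a \<in> A. R a b} R" by (rule poset_on_subset[OF po]) (use AB in auto)
  show "inj_on (\<lambda>a. (a, a, b)) {a \<in> A. R a b}" by (auto simp: inj_on_def)
  show "objs ?C = (\<lambda>a. (a, a, b)) ` {a \<in> A. R a b}" unfolding objs by auto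
  show "arrow_le ?C (x, x, b) (y, y, b) \<longleftrightarrow> R x y" if "x \<in> {a \<in> A. R a b}" "y \<in> {a \<in> A. R a b}" for x y
    using that unfolding arrow_le_def arrs by (auto simp: str)
qed

lemma undercategory_contractible:
  assumes po: "poset_on B R" and AB: "A \<subseteq> B" and b: "b \<in> B"
    and con: "contractible_poset R {a \<in> A. R b a}"
  shows "has_contractible_realization (undercategory (poset_cat A R) (poset_cat B R) inclusion_functor b)"
proof (rule has_contractible_realization_thin[OF _ _ _ con])
  let ?C = "undercategory (poset_cat A R) (poset_cat B R) inclusion_functor b"
  note defs = undercategory_def poset_cat_def inclusion_functor_def Let_def
  have R: "R x x" if "x \<in> A" for x using poset_onD(1)[OF po] AB that by blast
  have T: "R x z" if "x \<in> A" "y \<in> A" "z \<in> A" "R x y" "R y z" for x y z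
    using poset_onD(3)[OF po, of x y z] AB that by blast
  have objs: "objs ?C = {(a, b, a) | a. a \<in> A \<and> R b a}"
    using AB b by (auto simp: defs)
  have arrs: "arrs ?C = {((a, b, a), (a, a'), (a', b, a')) | a a'. a \<in> A \<and> a' \<in> A \<and> R b a \<and> R b a' \<and> R a a'}"
    using AB b by (auto simp: defs)
  have str: "src ?C (p, h, q) = p" "tgt ?C (p, h, q) = q" "idn ?C p = (p, (fst p, fst p), p)"
    "cmp ?C (q', k, r) (p, h, q) = (p, (fst h, snd k), r)" for p q q' r h k
    by (simp_all add: defs)
  show "is_category ?C"
    unfolding is_category_def objs arrs by (auto simp: str R intro: T)
  show "f = g" if "f \<in> arrs ?C" "g \<in> arrs ?C" "src ?C f = src ?C g" "tgt ?C f = tgt ?C g" for f g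
    using that unfolding arrs by (auto simp: str)
  show "poset_on {a \<in> A. R b a} R" by (rule poset_on_subset[OF po]) (use AB in auto)
  show "inj_on (\<lambda>a. (a, b, a)) {a \<in> A. R b a}" by (auto simp: inj_on_def)
  show "objs ?C = (\<lambda>a. (a, b, a)) ` {a \<in> A. R b a}" unfolding objs by auto
  show "arrow_le ?C (x, b, x) (y, b, y) \<longleftrightarrow> R x y" if "x \<in> {a \<in> A. R b a}" "y \<in> {a \<in> A. R b a}" for x y
    using that unfolding arrow_le_def arrs by (auto simp: str)
qed

theorem theorem1p1:
  fixes n :: nat and S :: "'a set" and A B :: "'a graph_obj set"
  assumes "n \<ge> 1" and "finite S"
    and "A \<subseteq> B" and "B \<subseteq> Ke_objs n S"
  shows "(M_down_objs n S \<subseteq> A \<longrightarrow>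
            homotopy_initial (poset_cat A (G_le S)) (poset_cat B (G_le S)) inclusion_functor) \<and>
         (M_up_objs n S \<subseteq> A \<longrightarrow>
            homotopy_final (poset_cat A (G_le S)) (poset_cat B (G_le S)) inclusion_functor)"
proof -
  have G: "B \<subseteq> G_objs n S" using assms(4) by (auto simp: Ke_objs_def)
  have acyc: "level_acyclic S \<mu>" if "\<mu> \<in> B" for \<mu>
    using Ke_level_acyclic[OF assms(2)] assms(4) that by blast
  have po: "poset_on B (G_le S)" by (rule poset_on_subset[OF poset_on_G_objs G])
  have cat: "is_category (poset_cat X (G_le S))" for X :: "'a graph_obj set"
    by (rule is_category_poset_cat) (auto intro: G_le_refl G_le_trans)
  have "has_contractible_realization
      (overcategory (poset_cat A (G_le S)) (poset_cat B (G_le S)) inclusion_functor b)"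
    if "M_down_objs n S \<subseteq> A" "b \<in> B" for b
    by (rule overcategory_contractible[OF po assms(3) that(2)],
        rule contractible_below[OF assms(2), of _ n]) (use that assms(3) G acyc in auto)
  moreover have "has_contractible_realization
      (undercategory (poset_cat A (G_le S)) (poset_cat B (G_le S)) inclusion_functor b)"
    if "M_up_objs n S \<subseteq> A" "b \<in> B" for b
    by (rule undercategory_contractible[OF po assms(3) that(2)],
        rule contractible_above[OF assms(1,2)]) (use that assms(3) G acyc in auto)
  moreover have "objs (poset_cat B (G_le S)) = B" by (simp add: poset_cat_def)
  ultimately show ?thesis
    using cat is_functor_inclusion[OF assms(3)] unfolding homotopy_initial_def homotopy_final_def by simp
qed

end
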